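(* Every connected projective aOka-1 manifold is rationally connected.
   Context: A connected complex manifold $X$ is rationally connected if any pair of points in $X$ can be joined by a rational curve, i.e. for all $p,q\in X$ there is a morphism $\mathbb{P}^1\to X$ whose image contains $p$ and $q$. An algebraic manifold is a smooth complex algebraic variety; morphisms are regular (algebraic) maps. An affine algebraic Riemann surface is the complement of a nonempty finite set of points in a compact Riemann surface (equivalently, a smooth connected affine algebraic curve over $\mathbb{C}$). A compact subset $K$ of an open Riemann surface $R$ is Runge if $R\setminus K$ has no relatively compact connected components. $\mathrm{dist}_X$ denotes a distance function on $X$ inducing the manifold topology (its choice is immaterial). A complex algebraic manifold $X$ is algebraically Oka-1 (aOka-1) if for any affine algebraic Riemann surface $R$, Runge compact set $K$ in $R$, finite set $A\subset K$, continuous map $f:R\to X$ which is holomorphic on a neighbourhood of $K$, number $\epsilon>0$, and integer $k\ge 1$, there is a morphism $F:R\to X$ which is homotopic to $f$ and satisfies (1) $\max_{p\in K}\mathrm{dist}_X(F(p),f(p))<\epsilon$, and (2) $F$ agrees with $f$ to order $k$ at every point of $A$ (i.e. the $k$-jets coincide). *)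

theory Defs
  imports "HOL-Complex_Analysis.Complex_Analysis" "HOL-Library.Function_Algebras"
begin

section \<open>Affine and projective space\<close>

text \<open>
  Dimensions have to be quantified inside definitions, so the affine space of dimension \<open>n\<close> is
  the set of sequences vanishing from index \<open>n\<close> on. The product topology of
  \<^typ>\<open>nat \<Rightarrow> complex\<close> induces the Euclidean topology on it.
\<close>

definition cspace :: "nat \<Rightarrow> (nat \<Rightarrow> complex) set" where
  "cspace n = {x. \<forall>i\<ge>n. x i = 0}"

global_interpretation cvec: vector_space "\<lambda>(c::complex) (v::nat \<Rightarrow> complex). (\<lambda>i. c * v i)"
  defines cspan = cvec.span and cdim = cvec.dim
  by unfold_locales (auto simp: fun_eq_iff algebra_simps)

text \<open>A point of projective \<open>N\<close>-space is a line through the origin of affine \<open>(N + 1)\<close>-space.\<close>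

definition proj_space :: "nat \<Rightarrow> (nat \<Rightarrow> complex) set set" where
  "proj_space N = {cspan {v} |v. v \<in> cspace (Suc N) - {0}}"

definition proj_topology :: "nat \<Rightarrow> (nat \<Rightarrow> complex) set topology" where
  "proj_topology N = topology (\<lambda>U. U \<subseteq> proj_space N \<and>
     openin (top_of_set (cspace (Suc N) - {0})) {v \<in> cspace (Suc N) - {0}. cspan {v} \<in> U})"

lemma openin_proj_topology:
  "openin (proj_topology N) U \<longleftrightarrow> U \<subseteq> proj_space N \<and>
     openin (top_of_set (cspace (Suc N) - {0})) {v \<in> cspace (Suc N) - {0}. cspan {v} \<in> U}"
proof -
  let ?A = "cspace (Suc N) - {0}"
  let ?L = "\<lambda>U. U \<subseteq> proj_space N \<and> openin (top_of_set ?A) {v \<in> ?A. cspan {v} \<in> U}"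
  have "istopology ?L"
    unfolding istopology_def
  proof (intro conjI allI impI)
    fix S T assume S: "?L S" and T: "?L T"
    then show "S \<inter> T \<subseteq> proj_space N" by blast
    have "{v \<in> ?A. cspan {v} \<in> S \<inter> T} = {v \<in> ?A. cspan {v} \<in> S} \<inter> {v \<in> ?A. cspan {v} \<in> T}"
      by blast
    then show "openin (top_of_set ?A) {v \<in> ?A. cspan {v} \<in> S \<inter> T}"
      using S T openin_Int[of "top_of_set ?A"] by presburger
  next
    fix \<K> assume K: "\<forall>K\<in>\<K>. ?L K"
    then show "\<Union> \<K> \<subseteq> proj_space N" by blast
    have "{v \<in> ?A. cspan {v} \<in> \<Union> \<K>} = (\<Union>K\<in>\<K>. {v \<in> ?A. cspan {v} \<in> K})"
      by blast
    moreover have "openin (top_of_set ?A) (\<Union>K\<in>\<K>. {v \<in> ?A. cspan {v} \<in> K})"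
      using K by (intro openin_Union) auto
    ultimately show "openin (top_of_set ?A) {v \<in> ?A. cspan {v} \<in> \<Union> \<K>}" by presburger
  qed
  then show ?thesis by (simp add: proj_topology_def)
qed

text \<open>
  The standard affine chart number \<open>j\<close>; \<open>proj_coord j L\<close> is the representative of \<open>L\<close> with
  \<open>j\<close>-th coordinate 1, i.e. the tuple of affine coordinates of \<open>L\<close>.
\<close>

definition proj_chart :: "nat \<Rightarrow> nat \<Rightarrow> (nat \<Rightarrow> complex) set set" where
  "proj_chart N j = {L \<in> proj_space N. \<exists>v\<in>L. v j \<noteq> 0}"

definition proj_coord :: "nat \<Rightarrow> (nat \<Rightarrow> complex) set \<Rightarrow> nat \<Rightarrow> complex" where
  "proj_coord j L = (THE v. v \<in> L \<and> v j = 1)"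

section \<open>Polynomials\<close>

text \<open>
  Since the complex field is infinite, polynomials are identified with polynomial functions.
\<close>

definition poly_fun :: "nat \<Rightarrow> ((nat \<Rightarrow> complex) \<Rightarrow> complex) \<Rightarrow> bool" where
  "poly_fun n f \<longleftrightarrow> (\<exists>d c. f = (\<lambda>x.
     \<Sum>\<alpha> | (\<forall>i\<ge>n. \<alpha> i = 0) \<and> (\<Sum>i<n. \<alpha> i) \<le> d. c \<alpha> * (\<Prod>i<n. x i ^ \<alpha> i)))"

definition form_fun :: "nat \<Rightarrow> nat \<Rightarrow> ((nat \<Rightarrow> complex) \<Rightarrow> complex) \<Rightarrow> bool" where
  "form_fun n d f \<longleftrightarrow> (\<exists>c. f = (\<lambda>x.
     \<Sum>\<alpha> | (\<forall>i\<ge>n. \<alpha> i = 0) \<and> (\<Sum>i<n. \<alpha> i) = d. c \<alpha> * (\<Prod>i<n. x i ^ \<alpha> i)))"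

lemma finite_exponents: "finite {\<alpha>::nat \<Rightarrow> nat. (\<forall>i\<ge>n. \<alpha> i = 0) \<and> (\<Sum>i<n. \<alpha> i) \<le> d}"
proof (rule finite_subset)
  show "finite {\<alpha>. \<forall>i. (i \<in> {..<n} \<longrightarrow> \<alpha> i \<in> {..d}) \<and> (i \<notin> {..<n} \<longrightarrow> \<alpha> i = (0::nat))}"
    by (rule finite_set_of_finite_funs) auto
  show "{\<alpha>::nat \<Rightarrow> nat. (\<forall>i\<ge>n. \<alpha> i = 0) \<and> (\<Sum>i<n. \<alpha> i) \<le> d} \<subseteq>
      {\<alpha>. \<forall>i. (i \<in> {..<n} \<longrightarrow> \<alpha> i \<in> {..d}) \<and> (i \<notin> {..<n} \<longrightarrow> \<alpha> i = (0::nat))}"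
    by (auto intro: order_trans[OF member_le_sum[where A = "{..<n}"]])
qed

lemma finite_exponents_eq: "finite {\<alpha>::nat \<Rightarrow> nat. (\<forall>i\<ge>n. \<alpha> i = 0) \<and> (\<Sum>i<n. \<alpha> i) = d}"
  by (rule finite_subset[OF _ finite_exponents[of n d]]) auto

definition dir_deriv ::
  "((nat \<Rightarrow> complex) \<Rightarrow> complex) \<Rightarrow> (nat \<Rightarrow> complex) \<Rightarrow> (nat \<Rightarrow> complex) \<Rightarrow> complex" where
  "dir_deriv f x w = deriv (\<lambda>t. f (\<lambda>i. x i + t * w i)) 0"

section \<open>Affine algebraic Riemann surfaces\<close>

definition affine_algebraic_set :: "nat \<Rightarrow> (nat \<Rightarrow> complex) set \<Rightarrow> bool" where
  "affine_algebraic_set n R \<longleftrightarrow>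
     (\<exists>S. (\<forall>f\<in>S. poly_fun n f) \<and> R = {x \<in> cspace n. \<forall>f\<in>S. f x = 0})"

text \<open>The Zariski tangent space; the differentials of the whole vanishing ideal are used.\<close>

definition affine_tangent_space ::
  "nat \<Rightarrow> (nat \<Rightarrow> complex) set \<Rightarrow> (nat \<Rightarrow> complex) \<Rightarrow> (nat \<Rightarrow> complex) set" where
  "affine_tangent_space n R x =
     {w \<in> cspace n. \<forall>f. poly_fun n f \<and> (\<forall>y\<in>R. f y = 0) \<longrightarrow> dir_deriv f x w = 0}"

text \<open>
  A smooth connected affine algebraic curve. A (reduced) algebraic set whose Zariski tangent
  spaces all have dimension 1 is smooth of pure dimension 1 (Jacobian criterion).
\<close>

definition affine_riemann_surface :: "nat \<Rightarrow> (nat \<Rightarrow> complex) set \<Rightarrow> bool" where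
  "affine_riemann_surface n R \<longleftrightarrow>
     affine_algebraic_set n R \<and> R \<noteq> {} \<and> connected R \<and>
     (\<forall>x\<in>R. cdim (affine_tangent_space n R x) = 1)"

text \<open>
  Local holomorphic parametrizations of an embedded curve, i.e. inverses of its holomorphic charts.
\<close>

definition local_param ::
  "nat \<Rightarrow> (nat \<Rightarrow> complex) set \<Rightarrow> complex set \<Rightarrow> (complex \<Rightarrow> nat \<Rightarrow> complex) \<Rightarrow> bool" where
  "local_param n R V \<gamma> \<longleftrightarrow>
     open V \<and> openin (top_of_set R) (\<gamma> ` V) \<and>
     (\<exists>\<gamma>'. homeomorphism V (\<gamma> ` V) \<gamma> \<gamma>') \<and>
     (\<forall>i<n. (\<lambda>z. \<gamma> z i) holomorphic_on V) \<and>
     (\<forall>z\<in>V. \<exists>i<n. deriv (\<lambda>z. \<gamma> z i) z \<noteq> 0)"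

definition runge_compact :: "(nat \<Rightarrow> complex) set \<Rightarrow> (nat \<Rightarrow> complex) set \<Rightarrow> bool" where
  "runge_compact R K \<longleftrightarrow>
     compact K \<and> K \<subseteq> R \<and> (\<forall>C\<in>components (R - K). \<not> compact (R \<inter> closure C))"

section \<open>Maps from a Riemann surface to projective space\<close>

definition holomorphic_curve ::
  "nat \<Rightarrow> complex set \<Rightarrow> (complex \<Rightarrow> (nat \<Rightarrow> complex) set) \<Rightarrow> bool" where
  "holomorphic_curve N V g \<longleftrightarrow>
     continuous_map (top_of_set V) (proj_topology N) g \<and>
     (\<forall>j\<le>N. \<forall>i\<le>N. (\<lambda>z. proj_coord j (g z) i) holomorphic_on {z \<in> V. g z \<in> proj_chart N j})"

definition holomorphic_map_on ::
  "nat \<Rightarrow> (nat \<Rightarrow> complex) set \<Rightarrow> nat \<Rightarrow> (nat \<Rightarrow> complex) set \<Rightarrow>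
   ((nat \<Rightarrow> complex) \<Rightarrow> (nat \<Rightarrow> complex) set) \<Rightarrow> bool" where
  "holomorphic_map_on n R N U f \<longleftrightarrow>
     (\<forall>V \<gamma>. local_param n R V \<gamma> \<and> \<gamma> ` V \<subseteq> U \<longrightarrow> holomorphic_curve N V (f \<circ> \<gamma>))"

text \<open>Equality of the \<open>k\<close>-jets at \<open>p\<close>, expressed in local holomorphic coordinates.\<close>

definition agree_to_order ::
  "nat \<Rightarrow> (nat \<Rightarrow> complex) set \<Rightarrow> nat \<Rightarrow> nat \<Rightarrow> (nat \<Rightarrow> complex) \<Rightarrow>
   ((nat \<Rightarrow> complex) \<Rightarrow> (nat \<Rightarrow> complex) set) \<Rightarrow>
   ((nat \<Rightarrow> complex) \<Rightarrow> (nat \<Rightarrow> complex) set) \<Rightarrow> bool" where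
  "agree_to_order n R N k p F f \<longleftrightarrow> F p = f p \<and>
     (\<forall>V \<gamma> z j. local_param n R V \<gamma> \<and> z \<in> V \<and> \<gamma> z = p \<and> j \<le> N \<and> f p \<in> proj_chart N j \<longrightarrow>
       (\<forall>i\<le>N. \<forall>m\<le>k. (deriv ^^ m) (\<lambda>w. proj_coord j (F (\<gamma> w)) i) z =
                      (deriv ^^ m) (\<lambda>w. proj_coord j (f (\<gamma> w)) i) z))"

text \<open>
  Morphisms (regular maps) to a subvariety \<open>X\<close> of projective \<open>N\<close>-space: near every point, on a
  basic Zariski open neighbourhood \<open>h \<noteq> 0\<close>, the map has homogeneous coordinates given by
  polynomials without common zero (forms of equal degree, if the source is projective).
\<close>

definition affine_morphism ::
  "nat \<Rightarrow> (nat \<Rightarrow> complex) set \<Rightarrow> nat \<Rightarrow> (nat \<Rightarrow> complex) set set \<Rightarrow>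
   ((nat \<Rightarrow> complex) \<Rightarrow> (nat \<Rightarrow> complex) set) \<Rightarrow> bool" where
  "affine_morphism n R N X F \<longleftrightarrow> F ` R \<subseteq> X \<and>
     (\<forall>p\<in>R. \<exists>h g. poly_fun n h \<and> (\<forall>i\<le>N. poly_fun n (g i)) \<and> h p \<noteq> 0 \<and>
       (\<forall>x\<in>R. h x \<noteq> 0 \<longrightarrow>
          (\<exists>i\<le>N. g i x \<noteq> 0) \<and> F x = cspan {\<lambda>i. if i \<le> N then g i x else 0}))"

definition proj_morphism ::
  "nat \<Rightarrow> (nat \<Rightarrow> complex) set set \<Rightarrow> nat \<Rightarrow> (nat \<Rightarrow> complex) set set \<Rightarrow>
   ((nat \<Rightarrow> complex) set \<Rightarrow> (nat \<Rightarrow> complex) set) \<Rightarrow> bool" where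
  "proj_morphism M Y N X \<phi> \<longleftrightarrow> \<phi> ` Y \<subseteq> X \<and>
     (\<forall>P\<in>Y. \<exists>e d h g. form_fun (Suc M) e h \<and> (\<forall>i\<le>N. form_fun (Suc M) d (g i)) \<and>
       (\<forall>v\<in>P - {0}. h v \<noteq> 0) \<and>
       (\<forall>v \<in> cspace (Suc M) - {0}. cspan {v} \<in> Y \<and> h v \<noteq> 0 \<longrightarrow>
          (\<exists>i\<le>N. g i v \<noteq> 0) \<and> \<phi> (cspan {v}) = cspan {\<lambda>i. if i \<le> N then g i v else 0}))"

section \<open>Projective manifolds, algebraically Oka-1 manifolds, rational connectedness\<close>

definition proj_algebraic_set :: "nat \<Rightarrow> (nat \<Rightarrow> complex) set set \<Rightarrow> bool" where
  "proj_algebraic_set N X \<longleftrightarrow>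
     (\<exists>S. (\<forall>f\<in>S. \<exists>d. form_fun (Suc N) d f) \<and> X = {L \<in> proj_space N. \<forall>f\<in>S. \<forall>v\<in>L - {0}. f v = 0})"

text \<open>The Zariski tangent space, at \<open>v\<close>, of the affine cone over \<open>X\<close>.\<close>

definition cone_tangent_space ::
  "nat \<Rightarrow> (nat \<Rightarrow> complex) set set \<Rightarrow> (nat \<Rightarrow> complex) \<Rightarrow> (nat \<Rightarrow> complex) set" where
  "cone_tangent_space N X v = {w \<in> cspace (Suc N).
     \<forall>f d. form_fun (Suc N) d f \<and> (\<forall>L\<in>X. \<forall>u\<in>L - {0}. f u = 0) \<longrightarrow> dir_deriv f v w = 0}"

text \<open>
  Smooth of pure dimension \<open>d\<close>, by the projective Jacobian criterion; a connected smooth variety is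
  always pure-dimensional.
\<close>

definition projective_manifold :: "nat \<Rightarrow> (nat \<Rightarrow> complex) set set \<Rightarrow> bool" where
  "projective_manifold N X \<longleftrightarrow> proj_algebraic_set N X \<and>
     (\<exists>d. \<forall>L\<in>X. \<forall>v\<in>L - {0}. cdim (cone_tangent_space N X v) = Suc d)"

text \<open>
  Some distance function inducing the manifold topology is used; since \<open>K\<close> is compact and the
  maps are continuous, its choice is immaterial. \<open>F\<close> and \<open>f\<close> matter only on
  \<open>R\<close>; the bound on the maximum over \<open>K\<close> is stated pointwise, which also covers empty \<open>K\<close>.
\<close>

definition aOka1 :: "nat \<Rightarrow> (nat \<Rightarrow> complex) set set \<Rightarrow> bool" where
  "aOka1 N X \<longleftrightarrow> (\<exists>dist\<^sub>X. Metric_space X dist\<^sub>X \<and>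
     Metric_space.mtopology X dist\<^sub>X = subtopology (proj_topology N) X \<and>
     (\<forall>n R K A f (\<epsilon>::real) (k::nat).
        affine_riemann_surface n R \<and> runge_compact R K \<and> finite A \<and> A \<subseteq> K \<and>
        continuous_map (top_of_set R) (subtopology (proj_topology N) X) f \<and>
        (\<exists>U. openin (top_of_set R) U \<and> K \<subseteq> U \<and> holomorphic_map_on n R N U f) \<and>
        \<epsilon> > 0 \<and> k \<ge> 1 \<longrightarrow>
        (\<exists>F. affine_morphism n R N X F \<and>
           homotopic_with (\<lambda>_. True) (top_of_set R) (subtopology (proj_topology N) X) f F \<and>
           (\<forall>p\<in>K. dist\<^sub>X (F p) (f p) < \<epsilon>) \<and>
           (\<forall>p\<in>A. agree_to_order n R N k p F f))))"

definition rationally_connected :: "nat \<Rightarrow> (nat \<Rightarrow> complex) set set \<Rightarrow> bool" where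
  "rationally_connected N X \<longleftrightarrow>
     (\<forall>p\<in>X. \<forall>q\<in>X. \<exists>\<phi>. proj_morphism 1 (proj_space 1) N X \<phi> \<and> {p, q} \<subseteq> \<phi> ` proj_space 1)"

end

theory Submission
  imports Defs "Jordan_Normal_Form.Determinant"
begin

text \<open>
  Join \<open>p\<close> and \<open>q\<close> by a path in \<open>X\<close> and extend it to a continuous map from the complex line to
  \<open>X\<close> that equals \<open>p\<close> near \<open>0\<close> and \<open>q\<close> near \<open>1\<close>. Being aOka-1 yields a morphism \<open>F\<close> from the affine
  line to \<open>X\<close> with \<open>F 0 = p\<close> and \<open>F 1 = q\<close>, and \<open>F\<close> extends to the projective line because \<open>X\<close> is
  closed in projective space.

  The path exists because \<open>X\<close> is locally path connected, which has to be extracted from the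
  constancy of the dimension of the Zariski tangent spaces. At a point \<open>v\<close> of the cone over \<open>X\<close> take
  vanishing forms \<open>f\<^sub>1, \<dots>, f\<^sub>r\<close> whose differentials are a basis of the conormal space. A nearby point
  \<open>u\<close> of the cone is joined to \<open>v\<close> by a holomorphic curve in the zero set of the \<open>f\<^sub>i\<close>. For any
  vanishing form \<open>g\<close>, the maximal minors of the Jacobian matrix of \<open>f\<^sub>1, \<dots>, f\<^sub>r, g\<close> vanish on the cone,
  hence are vanishing forms as well, and up to a unit the derivative of \<open>g\<close> along the curve is such a minor.
  So all derivatives of \<open>g\<close> along the curve are zero at \<open>v\<close>, and the curve lies in the cone.
\<close>

section \<open>Forms\<close>

lemma form_fun_0: "form_fun n d (\<lambda>x. 0)"
  unfolding form_fun_def by (rule exI[of _ "\<lambda>_. 0"]) simp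

lemma form_fun_add: "form_fun n d f \<Longrightarrow> form_fun n d g \<Longrightarrow> form_fun n d (\<lambda>x. f x + g x)"
proof -
  assume "form_fun n d f" "form_fun n d g"
  then obtain c c' where
    "f = (\<lambda>x. \<Sum>\<alpha> | (\<forall>i\<ge>n. \<alpha> i = 0) \<and> (\<Sum>i<n. \<alpha> i) = d. c \<alpha> * (\<Prod>i<n. x i ^ \<alpha> i))"
    "g = (\<lambda>x. \<Sum>\<alpha> | (\<forall>i\<ge>n. \<alpha> i = 0) \<and> (\<Sum>i<n. \<alpha> i) = d. c' \<alpha> * (\<Prod>i<n. x i ^ \<alpha> i))"
    unfolding form_fun_def by auto
  then show ?thesis unfolding form_fun_def
    by (intro exI[of _ "\<lambda>\<alpha>. c \<alpha> + c' \<alpha>"]) (simp add: sum.distrib distrib_right)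
qed

lemma form_fun_cmult:
  assumes "form_fun n d f" shows "form_fun n d (\<lambda>x. a * f x)"
proof -
  obtain c where
    "f = (\<lambda>x. \<Sum>\<alpha> | (\<forall>i\<ge>n. \<alpha> i = 0) \<and> (\<Sum>i<n. \<alpha> i) = d. c \<alpha> * (\<Prod>i<n. x i ^ \<alpha> i))"
    using assms unfolding form_fun_def by auto
  then show ?thesis unfolding form_fun_def
    by (intro exI[of _ "\<lambda>\<alpha>. a * c \<alpha>"]) (simp add: sum_distrib_left mult.assoc)
qed

lemma form_fun_sum: "(\<And>i. i \<in> A \<Longrightarrow> form_fun n d (f i)) \<Longrightarrow> form_fun n d (\<lambda>x. \<Sum>i\<in>A. f i x)"
  by (induction A rule: infinite_finite_induct) (simp_all add: form_fun_0 form_fun_add)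

lemma form_fun_monomial:
  assumes "\<And>i. i \<ge> n \<Longrightarrow> \<alpha> i = 0" "(\<Sum>i<n. \<alpha> i) = d"
  shows "form_fun n d (\<lambda>x. \<Prod>i<n. x i ^ \<alpha> i)"
  unfolding form_fun_def
proof (intro exI[of _ "\<lambda>\<beta>. if \<beta> = \<alpha> then 1 else 0"] ext)
  fix x :: "nat \<Rightarrow> complex"
  let ?A = "{\<alpha>::nat \<Rightarrow> nat. (\<forall>i\<ge>n. \<alpha> i = 0) \<and> (\<Sum>i<n. \<alpha> i) = d}"
  have "(\<Sum>\<beta>\<in>?A. (if \<beta> = \<alpha> then 1 else 0) * (\<Prod>i<n. x i ^ \<beta> i)) =
      (\<Sum>\<beta>\<in>?A. if \<beta> = \<alpha> then (\<Prod>i<n. x i ^ \<beta> i) else 0)"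
    by (rule sum.cong) auto
  also have "\<dots> = (\<Prod>i<n. x i ^ \<alpha> i)"
    using assms by (simp add: sum.delta finite_exponents_eq)
  finally show "(\<Prod>i<n. x i ^ \<alpha> i) = (\<Sum>\<beta>\<in>?A. (if \<beta> = \<alpha> then 1 else 0) * (\<Prod>i<n. x i ^ \<beta> i))" by simp
qed

text \<open>Partial sums of the monomial expansion are again forms of degree \<open>d\<close>, so a
  property stable under addition needs checking on scaled monomials only. This spares later proofs
  the sum over multi-indices.\<close>

lemma form_fun_induct [consumes 1, case_names zero add monomial]:
  assumes "form_fun n d f"
    and "P (\<lambda>x. 0)"
    and "\<And>f g. form_fun n d f \<Longrightarrow> form_fun n d g \<Longrightarrow> P f \<Longrightarrow> P g \<Longrightarrow> P (\<lambda>x. f x + g x)"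
    and "\<And>c \<alpha>. (\<And>i. i \<ge> n \<Longrightarrow> \<alpha> i = 0) \<Longrightarrow> (\<Sum>i<n. \<alpha> i) = d \<Longrightarrow> P (\<lambda>x. c * (\<Prod>i<n. x i ^ \<alpha> i))"
  shows "P f"
proof -
  let ?A = "{\<alpha>::nat \<Rightarrow> nat. (\<forall>i\<ge>n. \<alpha> i = 0) \<and> (\<Sum>i<n. \<alpha> i) = d}"
  obtain c where f: "f = (\<lambda>x. \<Sum>\<alpha>\<in>?A. c \<alpha> * (\<Prod>i<n. x i ^ \<alpha> i))"
    using assms(1) unfolding form_fun_def by auto
  have "B \<subseteq> ?A \<Longrightarrow> P (\<lambda>x. \<Sum>\<alpha>\<in>B. c \<alpha> * (\<Prod>i<n. x i ^ \<alpha> i))" for B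
  proof (induction B rule: infinite_finite_induct)
    case (insert \<alpha> B)
    then show ?case
      by (auto intro!: assms(3,4) form_fun_cmult form_fun_monomial form_fun_sum)
  qed (simp_all add: assms(2))
  then show ?thesis unfolding f by blast
qed

lemma form_fun_mult:
  assumes "form_fun n d f" "form_fun n e g"
  shows "form_fun n (d + e) (\<lambda>x. f x * g x)"
  using assms(1)
proof (induction rule: form_fun_induct)
  case zero then show ?case by (simp add: form_fun_0)
next
  case (add f f') then show ?case by (simp add: distrib_right form_fun_add)
next
  case (monomial c \<alpha>)
  from assms(2) show ?case
  proof (induction rule: form_fun_induct)
    case zero then show ?case by (simp add: form_fun_0)
  next
    case (add f f') then show ?case by (simp add: distrib_left form_fun_add)
  next
    case (monomial c' \<beta>)
    have "form_fun n (d + e) (\<lambda>x. (c * c') * (\<Prod>i<n. x i ^ (\<alpha> i + \<beta> i)))"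
      using monomial \<open>\<And>i. i \<ge> n \<Longrightarrow> \<alpha> i = 0\<close> \<open>(\<Sum>i<n. \<alpha> i) = d\<close>
      by (intro form_fun_cmult form_fun_monomial) (auto simp: sum.distrib)
    then show ?case by (simp add: power_add prod.distrib mult_ac)
  qed
qed

lemma form_fun_const: "form_fun n 0 (\<lambda>x. c)"
  using form_fun_cmult[OF form_fun_monomial[of n "\<lambda>_. 0" 0], of c] by simp

lemma form_fun_prod:
  "finite A \<Longrightarrow> (\<And>i. i \<in> A \<Longrightarrow> form_fun n (d i) (f i)) \<Longrightarrow>
    form_fun n (\<Sum>i\<in>A. d i) (\<lambda>x. \<Prod>i\<in>A. f i x)"
  by (induction A rule: finite_induct) (simp_all add: form_fun_const form_fun_mult)

lemma form_fun_scale: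
  assumes "form_fun n d f" shows "f (\<lambda>i. a * x i) = a ^ d * f x"
  using assms
proof (induction rule: form_fun_induct)
  case (monomial c \<alpha>)
  have "(\<Prod>i<n. a ^ \<alpha> i) = a ^ d" using monomial by (simp add: power_sum[symmetric])
  then show ?case by (simp add: power_mult_distrib prod.distrib)
qed (simp_all add: distrib_left)

section \<open>Continuity and derivatives of forms\<close>

lemma form_fun_tendsto:
  assumes "form_fun n d f" "\<And>k. k < n \<Longrightarrow> ((\<lambda>t. \<phi> t k) \<longlongrightarrow> v k) F"
  shows "((\<lambda>t. f (\<phi> t)) \<longlongrightarrow> f v) F"
  using assms(1)
  by (induction rule: form_fun_induct) (auto intro!: tendsto_intros assms(2))

text \<open>A sequential argument replaces the unwieldy product topology by coordinatewise closeness.\<close>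

lemma form_fun_eps_delta:
  assumes "form_fun n d f" "\<eta> > 0"
  shows "\<exists>\<epsilon>>0. \<forall>u. (\<forall>k<n. cmod (u k - v k) < \<epsilon>) \<longrightarrow> cmod (f u - f v) < \<eta>"
proof (rule ccontr)
  assume "\<not> ?thesis"
  then have "\<forall>m. \<exists>u. (\<forall>k<n. cmod (u k - v k) < 1 / Suc m) \<and> \<not> cmod (f u - f v) < \<eta>"
    by (metis of_nat_0_less_iff zero_less_Suc zero_less_divide_1_iff)
  then obtain u where u: "\<And>m k. k < n \<Longrightarrow> cmod (u m k - v k) < 1 / Suc m"
      "\<And>m. \<not> cmod (f (u m) - f v) < \<eta>" by metis
  have "(\<lambda>m. u m k) \<longlonglongrightarrow> v k" if "k < n" for k
    unfolding LIM_zero_iff[of "\<lambda>m. u m k", symmetric]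
    by (rule Lim_null_comparison[OF _ lim_1_over_n[THEN LIMSEQ_Suc]])
      (use u(1)[OF that] in \<open>auto intro!: always_eventually less_imp_le\<close>)
  then have "(\<lambda>m. f (u m)) \<longlonglongrightarrow> f v"
    by (rule form_fun_tendsto[OF assms(1)])
  then show False using u(2) \<open>\<eta> > 0\<close> unfolding LIMSEQ_iff by (metis order_refl)
qed

text \<open>\<open>D k\<close> is the \<open>k\<close>-th partial derivative and the second clause
  is the chain rule. One \<open>D\<close> serves all curves, so that the partial derivatives are
  forms in their own right.\<close>

lemma form_fun_has_derivative:
  assumes "form_fun n d f"
  shows "\<exists>D. (\<forall>k<n. form_fun n (d - 1) (D k)) \<and>
    (\<forall>\<phi> \<phi>' t. (\<forall>k<n. ((\<lambda>t. \<phi> t k) has_field_derivative \<phi>' k) (at t)) \<longrightarrow>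
      ((\<lambda>t. f (\<phi> t)) has_field_derivative (\<Sum>k<n. D k (\<phi> t) * \<phi>' k)) (at t))"
  using assms
proof (induction rule: form_fun_induct)
  case zero
  show ?case by (rule exI[of _ "\<lambda>k x. 0"]) (simp add: form_fun_0)
next
  case (add f g)
  obtain D where
    D: "(\<forall>k<n. form_fun n (d - 1) (D k)) \<and>
    (\<forall>\<phi> \<phi>' t. (\<forall>k<n. ((\<lambda>t. \<phi> t k) has_field_derivative \<phi>' k) (at t)) \<longrightarrow>
      ((\<lambda>t. f (\<phi> t)) has_field_derivative (\<Sum>k<n. D k (\<phi> t) * \<phi>' k)) (at t))"
    using add.IH(1) ..
  obtain E where
    E: "(\<forall>k<n. form_fun n (d - 1) (E k)) \<and>
    (\<forall>\<phi> \<phi>' t. (\<forall>k<n. ((\<lambda>t. \<phi> t k) has_field_derivative \<phi>' k) (at t)) \<longrightarrow>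
      ((\<lambda>t. g (\<phi> t)) has_field_derivative (\<Sum>k<n. E k (\<phi> t) * \<phi>' k)) (at t))"
    using add.IH(2) ..
  show ?case
    by (rule exI[of _ "\<lambda>k x. D k x + E k x"])
      (use D E in \<open>simp add: distrib_right sum.distrib form_fun_add DERIV_add\<close>)
next
  case (monomial c \<alpha>)
  \<comment> \<open>Where \<open>\<alpha> k = 0\<close>, the truncated exponent
    \<open>\<alpha> k - 1\<close> would leave a monomial of degree \<open>d\<close>; the zero
    function is a form of every degree.\<close>
  let ?D = "\<lambda>k x. if \<alpha> k = 0 then 0 else (c * of_nat (\<alpha> k)) * (\<Prod>i<n. x i ^ (\<alpha>(k := \<alpha> k - 1)) i)"
  show ?case
  proof (rule exI[of _ ?D], intro conjI allI impI)
    fix k assume k: "k < n"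
    show "form_fun n (d - 1) (?D k)"
    proof (cases "\<alpha> k = 0")
      case False
      have "(\<Sum>i<n. (\<alpha>(k := \<alpha> k - 1)) i) + 1 = (\<Sum>i<n. \<alpha> i)"
        using k False by (subst (1 2) sum.remove[of _ k]) auto
      then show ?thesis using False monomial k
        by (simp del: fun_upd_apply, intro form_fun_cmult form_fun_monomial) auto
    qed (simp add: form_fun_0)
  next
    fix \<phi> :: "complex \<Rightarrow> nat \<Rightarrow> complex" and \<phi>' t
    assume \<phi>: "\<forall>k<n. ((\<lambda>t. \<phi> t k) has_field_derivative \<phi>' k) (at t)"
    have "((\<lambda>t. c * (\<Prod>i<n. \<phi> t i ^ \<alpha> i)) has_field_derivative
        c * (\<Sum>k<n. (of_nat (\<alpha> k) * (\<phi>' k * \<phi> t k ^ (\<alpha> k - Suc 0))) * (\<Prod>i\<in>{..<n} - {k}. \<phi> t i ^ \<alpha> i))) (at t)"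
      using \<phi> by (intro DERIV_cmult has_field_derivative_prod DERIV_power) auto
    also have "c * (\<Sum>k<n. (of_nat (\<alpha> k) * (\<phi>' k * \<phi> t k ^ (\<alpha> k - Suc 0))) * (\<Prod>i\<in>{..<n} - {k}. \<phi> t i ^ \<alpha> i))
      = (\<Sum>k<n. ?D k (\<phi> t) * \<phi>' k)"
      unfolding sum_distrib_left
    proof (rule sum.cong[OF refl], goal_cases)
      case (1 k)
      have "(\<Prod>i<n. \<phi> t i ^ (\<alpha>(k := \<alpha> k - 1)) i) = \<phi> t k ^ (\<alpha> k - Suc 0) * (\<Prod>i\<in>{..<n} - {k}. \<phi> t i ^ \<alpha> i)"
        using 1 by (subst prod.remove[of _ k]) auto
      then show ?case by (simp del: fun_upd_apply add: mult_ac)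
    qed
    finally show "((\<lambda>t. c * (\<Prod>i<n. \<phi> t i ^ \<alpha> i)) has_field_derivative (\<Sum>k<n. ?D k (\<phi> t) * \<phi>' k)) (at t)" .
  qed
qed

text \<open>The chain rule along the line \<open>x i + t * w i\<close> identifies the gradient sum
  with \<open>dir_deriv\<close>. The latter, defined through \<open>deriv\<close>, thereby becomes
  linear in the direction and a form in the base point.\<close>

lemma form_fun_gradient:
  assumes "form_fun n d f"
  obtains D where "\<And>k. k < n \<Longrightarrow> form_fun n (d - 1) (D k)"
    and "\<And>x w. dir_deriv f x w = (\<Sum>k<n. D k x * w k)"
    and "\<And>\<phi> \<phi>' t. (\<And>k. k < n \<Longrightarrow> ((\<lambda>t. \<phi> t k) has_field_derivative \<phi>' k) (at t)) \<Longrightarrow>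
      ((\<lambda>t. f (\<phi> t)) has_field_derivative dir_deriv f (\<phi> t) \<phi>') (at t)"
proof -
  obtain D where D: "\<And>k. k < n \<Longrightarrow> form_fun n (d - 1) (D k)" and
    chain: "\<And>\<phi> \<phi>' t. (\<And>k. k < n \<Longrightarrow> ((\<lambda>t. \<phi> t k) has_field_derivative \<phi>' k) (at t)) \<Longrightarrow>
      ((\<lambda>t. f (\<phi> t)) has_field_derivative (\<Sum>k<n. D k (\<phi> t) * \<phi>' k)) (at t)"
    using form_fun_has_derivative[OF assms] by blast
  have dir: "dir_deriv f x w = (\<Sum>k<n. D k x * w k)" for x w
  proof -
    have "((\<lambda>t. f (\<lambda>i. x i + t * w i)) has_field_derivative (\<Sum>k<n. D k (\<lambda>i. x i + 0 * w i) * w k)) (at 0)"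
      by (rule chain[of "\<lambda>t i. x i + t * w i"]) (auto intro!: derivative_eq_intros)
    then show ?thesis unfolding dir_deriv_def by (simp add: DERIV_imp_deriv)
  qed
  show ?thesis by (rule that[OF D dir]) (use chain dir in auto)
qed

text \<open>Hence the entries of a Jacobian matrix in fixed directions are forms, and so are its
  minors.\<close>

lemma form_fun_dir_deriv:
  assumes "form_fun n d f" shows "form_fun n (d - 1) (\<lambda>x. dir_deriv f x w)"
proof -
  obtain D where D: "\<And>k. k < n \<Longrightarrow> form_fun n (d - 1) (D k)"
    "\<And>x w. dir_deriv f x w = (\<Sum>k<n. D k x * w k)"
    by (rule form_fun_gradient[OF assms]) blast
  then show ?thesis
    by (simp add: mult.commute[of _ "w _"]) (intro form_fun_sum form_fun_cmult, simp)
qed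

lemma form_fun_chain:
  assumes "form_fun n d f" "\<And>k. k < n \<Longrightarrow> ((\<lambda>t. \<phi> t k) has_field_derivative \<phi>' k) (at t)"
  shows "((\<lambda>t. f (\<phi> t)) has_field_derivative dir_deriv f (\<phi> t) \<phi>') (at t)"
proof (rule form_fun_gradient[OF assms(1)])
  assume "\<And>\<phi> \<phi>' t. (\<And>k. k < n \<Longrightarrow> ((\<lambda>t. \<phi> t k) has_field_derivative \<phi>' k) (at t)) \<Longrightarrow>
    ((\<lambda>t. f (\<phi> t)) has_field_derivative dir_deriv f (\<phi> t) \<phi>') (at t)"
  then show ?thesis using assms(2) .
qed

lemma dir_deriv_sum:
  assumes "form_fun n d f"
  shows "dir_deriv f x (\<lambda>k. \<Sum>j\<in>A. a j * w j k) = (\<Sum>j\<in>A. a j * dir_deriv f x (w j))"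
proof -
  obtain D where D: "\<And>x w. dir_deriv f x w = (\<Sum>k<n. D k x * w k)"
    by (rule form_fun_gradient[OF assms]) blast
  show ?thesis unfolding D sum_distrib_left by (subst sum.swap) (simp add: mult_ac)
qed

lemma dir_deriv_diff:
  assumes "form_fun n d f"
  shows "dir_deriv f x (\<lambda>k. w k - w' k) = dir_deriv f x w - dir_deriv f x w'"
proof -
  obtain D where D: "\<And>x w. dir_deriv f x w = (\<Sum>k<n. D k x * w k)"
    by (rule form_fun_gradient[OF assms]) blast
  show ?thesis unfolding D by (simp add: right_diff_distrib sum_subtractf)
qed

lemma form_fun_holomorphic:
  assumes "form_fun n d f" "\<And>k. k < n \<Longrightarrow> (\<lambda>t. \<phi> t k) holomorphic_on S"
  shows "(\<lambda>t. f (\<phi> t)) holomorphic_on S"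
  using assms(1) by (induction rule: form_fun_induct) (auto intro!: holomorphic_intros assms(2))

lemma finite_form_eps_delta:
  assumes "finite A" "\<eta> > 0" "\<And>a. a \<in> A \<Longrightarrow> form_fun n (d a) (f a)"
  shows "\<exists>\<epsilon>>0. \<forall>u. (\<forall>k<n. cmod (u k - v k) < \<epsilon>) \<longrightarrow> (\<forall>a\<in>A. cmod (f a u - f a v) < \<eta>)"
  using assms(1,3)
proof (induction A rule: finite_induct)
  case (insert a A)
  then obtain \<epsilon> where "\<epsilon> > 0" and
    "\<forall>u. (\<forall>k<n. cmod (u k - v k) < \<epsilon>) \<longrightarrow> (\<forall>a\<in>A. cmod (f a u - f a v) < \<eta>)" by auto
  moreover obtain \<epsilon>' where "\<epsilon>' > 0" and
    "\<forall>u. (\<forall>k<n. cmod (u k - v k) < \<epsilon>') \<longrightarrow> cmod (f a u - f a v) < \<eta>"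
    using form_fun_eps_delta[OF insert.prems[of a] \<open>\<eta> > 0\<close>, of v] by blast
  ultimately show ?case by (intro exI[of _ "min \<epsilon> \<epsilon>'"]) auto
qed (auto intro: exI[of _ 1])

section \<open>Linear algebra in the space of sequences\<close>

lemma sum_fun_apply: "(\<Sum>i\<in>A. f i) x = (\<Sum>i\<in>A. f i x :: 'b::comm_monoid_add)"
  by (induction A rule: infinite_finite_induct) auto

lemma subspace_cspace: "cvec.subspace (cspace n)"
  by (auto simp: cvec.subspace_def cspace_def)

abbreviation axis_vec :: "nat \<Rightarrow> nat \<Rightarrow> complex" where
  "axis_vec k \<equiv> (\<lambda>i. if i = k then 1 else 0)"

lemma cspace_axis_vec_expansion:
  assumes "x \<in> cspace n" shows "(\<Sum>k<n. (\<lambda>i. x k * axis_vec k i)) = x"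
proof
  fix i
  have "(\<Sum>k<n. (\<lambda>i. x k * axis_vec k i)) i = (\<Sum>k<n. if k = i then x k else 0)"
    unfolding sum_fun_apply by (rule sum.cong) auto
  also have "\<dots> = x i" using assms by (cases "i < n") (auto simp: sum.delta cspace_def)
  finally show "(\<Sum>k<n. (\<lambda>i. x k * axis_vec k i)) i = x i" .
qed

lemma cspace_subset_span: "cspace n \<subseteq> cspan (axis_vec ` {..<n})"
proof
  fix x assume "x \<in> cspace n"
  have "(\<Sum>k<n. (\<lambda>i. x k * axis_vec k i)) \<in> cspan (axis_vec ` {..<n})"
    by (intro cvec.span_sum cvec.span_scale cvec.span_base) auto
  then show "x \<in> cspan (axis_vec ` {..<n})"
    using cspace_axis_vec_expansion[OF \<open>x \<in> cspace n\<close>] by simp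
qed

lemma inj_axis_vec: "inj axis_vec"
  by (auto simp: inj_def fun_eq_iff split: if_splits)

text \<open>Unlike the library's versions, the dimension bounds below need no finite-dimensional
  ambient space: \<open>cspace n\<close> is a proper subspace of the space of all sequences.\<close>

lemma cspace_independent_finite:
  assumes "cvec.independent B" "B \<subseteq> cspace n"
  shows "finite B" "card B \<le> n"
proof -
  have "finite B \<and> card B \<le> card (axis_vec ` {..<n})"
    using assms cspace_subset_span by (intro cvec.independent_span_bound) auto
  then show "finite B" "card B \<le> n"
    using card_image_le[of "{..<n}" axis_vec] by auto
qed

lemma independent_axis_vecs: "cvec.independent (axis_vec ` {..<n})"
proof (induction n)
  case (Suc n)
  have "axis_vec n \<notin> cspan (axis_vec ` {..<n})"
  proof
    assume "axis_vec n \<in> cspan (axis_vec ` {..<n})"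
    moreover have "cspan (axis_vec ` {..<n}) \<subseteq> cspace n"
      by (rule cvec.span_minimal[OF _ subspace_cspace]) (auto simp: cspace_def)
    ultimately have "axis_vec n \<in> cspace n" by (rule subsetD[rotated])
    then show False by (auto simp: cspace_def)
  qed
  then show ?case using Suc by (simp add: lessThan_Suc cvec.independent_insert)
qed (simp add: cvec.independent_empty)

text \<open>The \<open>w j\<close> are independent modulo \<open>T\<close>: adjoining them one at a
  time to a basis of \<open>T\<close> keeps it independent, and an independent set in
  \<open>cspace n\<close> has at most \<open>n\<close> elements.\<close>

lemma cdim_add_le:
  assumes T: "cvec.subspace T" "T \<subseteq> cspace n" and w: "\<And>j. j < m \<Longrightarrow> w j \<in> cspace n"
    and indep: "\<And>a. (\<lambda>k. \<Sum>j<m. a j * w j k) \<in> T \<Longrightarrow> \<forall>j<m. a j = 0"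
  shows "cdim T + m \<le> n"
proof -
  obtain B where B: "B \<subseteq> T" "cvec.independent B" "T \<subseteq> cspan B" "card B = cdim T"
    by (rule cvec.basis_exists)
  have "finite B" using cspace_independent_finite B(1,2) T(2) by blast
  have span_w: "\<exists>a. x = (\<lambda>k. \<Sum>j<l. a j * w j k)" if "x \<in> cspan (w ` {..<l})" for x l
    using that
  proof (induction rule: cvec.span_induct_alt)
    case base then show ?case by (intro exI[of _ "\<lambda>_. 0"]) (simp add: zero_fun_def)
  next
    case (step c x y)
    then obtain a j where a: "y = (\<lambda>k. \<Sum>j<l. a j * w j k)" and j: "j < l" "x = w j" by auto
    have "(\<Sum>i<l. (a(j := c + a j)) i * w i k) = c * w j k + (\<Sum>i<l. a i * w i k)" for k
      using j by (subst (1 2) sum.remove[of _ j]) (auto simp: algebra_simps)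
    then show ?case using a j by (intro exI[of _ "a(j := c + a j)"]) (simp add: plus_fun_def)
  qed
  have "l \<le> m \<Longrightarrow> cvec.independent (B \<union> w ` {..<l}) \<and> card (B \<union> w ` {..<l}) = card B + l" for l
  proof (induction l)
    case (Suc l)
    have "w l \<notin> cspan (B \<union> w ` {..<l})"
    proof
      assume "w l \<in> cspan (B \<union> w ` {..<l})"
      then obtain b x where bx: "w l = b + x" "b \<in> cspan B" "x \<in> cspan (w ` {..<l})"
        by (auto simp: cvec.span_Un)
      then obtain a where a: "x = (\<lambda>k. \<Sum>j<l. a j * w j k)" using span_w by blast
      have "b \<in> T" using bx(2) B(1) cvec.span_minimal[OF B(1) T(1)] by blast
      \<comment> \<open>The dependence \<open>w l = b + x\<close> rewritten as a combination of the
        \<open>w j\<close> that lies in \<open>T\<close>: coefficient 1 at \<open>l\<close>, zeros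
        beyond. By \<open>indep\<close> that 1 would be 0.\<close>
      let ?c = "\<lambda>j. if j < l then - a j else if j = l then 1 else 0"
      have "(\<Sum>j<m. ?c j * w j k) = b k" for k
      proof -
        have "(\<Sum>j<m. ?c j * w j k) = (\<Sum>j<Suc l. ?c j * w j k)"
          using Suc.prems by (intro sum.mono_neutral_right) auto
        also have "\<dots> = w l k - x k" by (simp add: a sum_negf)
        also have "\<dots> = b k" using bx(1) by simp
        finally show ?thesis .
      qed
      then have "(\<lambda>k. \<Sum>j<m. ?c j * w j k) \<in> T" using \<open>b \<in> T\<close> by simp
      then have c: "\<forall>j<m. ?c j = 0" by (rule indep)
      show False using c[rule_format, of l] Suc.prems by simp
    qed
    moreover from this have "w l \<notin> B \<union> w ` {..<l}" by (rule contra_subsetD[OF cvec.span_superset])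
    ultimately show ?case using Suc \<open>finite B\<close>
      by (auto simp: lessThan_Suc cvec.independent_insert)
  qed (simp add: B(2))
  then have "cvec.independent (B \<union> w ` {..<m})" "card (B \<union> w ` {..<m}) = card B + m" by auto
  moreover have "B \<union> w ` {..<m} \<subseteq> cspace n" using B(1) T(2) w by auto
  ultimately show ?thesis using cspace_independent_finite(2) B(4) by metis
qed

text \<open>The opposite count: a basis of \<open>T\<close> together with the \<open>w j\<close>
  spans \<open>cspace n\<close>.\<close>

lemma le_cdim_add:
  assumes T: "T \<subseteq> cspace n"
    and span: "\<And>x. x \<in> cspace n \<Longrightarrow> \<exists>a. (\<lambda>k. x k - (\<Sum>j<m. a j * w j k)) \<in> T"
  shows "n \<le> cdim T + m"
proof -
  obtain B where B: "B \<subseteq> T" "cvec.independent B" "T \<subseteq> cspan B" "card B = cdim T"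
    by (rule cvec.basis_exists)
  have "finite B" using cspace_independent_finite B(1,2) T by blast
  have "cspace n \<subseteq> cspan (B \<union> w ` {..<m})"
  proof
    fix x assume "x \<in> cspace n"
    then obtain a where a: "(\<lambda>k. x k - (\<Sum>j<m. a j * w j k)) \<in> T" using span by blast
    have "(\<Sum>j<m. (\<lambda>k. a j * w j k)) \<in> cspan (B \<union> w ` {..<m})"
      by (intro cvec.span_sum cvec.span_scale cvec.span_base) auto
    moreover have "(\<lambda>k. x k - (\<Sum>j<m. a j * w j k)) \<in> cspan (B \<union> w ` {..<m})"
      using a B(3) cvec.span_mono[of B "B \<union> w ` {..<m}"] by blast
    ultimately have "(\<lambda>k. x k - (\<Sum>j<m. a j * w j k)) + (\<Sum>j<m. (\<lambda>k. a j * w j k))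
        \<in> cspan (B \<union> w ` {..<m})" by (rule cvec.span_add[rotated])
    also have "(\<lambda>k. x k - (\<Sum>j<m. a j * w j k)) + (\<Sum>j<m. (\<lambda>k. a j * w j k)) = x"
      by (auto simp: fun_eq_iff sum_fun_apply)
    finally show "x \<in> cspan (B \<union> w ` {..<m})" .
  qed
  moreover have "axis_vec ` {..<n} \<subseteq> cspace n" by (auto simp: cspace_def)
  ultimately have "card (axis_vec ` {..<n}) \<le> card (B \<union> w ` {..<m})"
    using cvec.independent_span_bound[of "B \<union> w ` {..<m}" "axis_vec ` {..<n}"]
      independent_axis_vecs \<open>finite B\<close> by auto
  also have "\<dots> \<le> card B + m"
    using card_Un_le[of B "w ` {..<m}"] card_image_le[of "{..<m}" w] by simp
  finally show ?thesis using B(4) by (simp add: card_image inj_on_subset[OF inj_axis_vec])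
qed

text \<open>A maximal dual system exists since its vectors are independent in \<open>cspace n\<close>.\<close>

lemma maximal_dual_system:
  fixes \<Lambda> :: "((nat \<Rightarrow> complex) \<Rightarrow> complex) set"
  assumes lin: "\<And>l. l \<in> \<Lambda> \<Longrightarrow> \<exists>c. \<forall>w. l w = (\<Sum>k<n. c k * w k)"
  shows "\<exists>(r::nat) l w. (\<forall>i<r. l i \<in> \<Lambda> \<and> w i \<in> cspace n \<and> (\<forall>j<r. l i (w j) = (if i = j then 1 else 0))) \<and>
    (\<forall>x\<in>cspace n. (\<forall>i<r. l i x = 0) \<longrightarrow> (\<forall>g\<in>\<Lambda>. g x = 0))"
proof -
  define dual where "dual r l w \<longleftrightarrow> (\<forall>i<r. l i \<in> \<Lambda>) \<and> (\<forall>i<r. w i \<in> cspace n) \<and>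
    (\<forall>i<r. \<forall>j<r. l i (w j) = (if i = j then 1 else (0::complex)))" for r :: nat and l and w :: "nat \<Rightarrow> nat \<Rightarrow> complex"
  have lin_sum: "l (\<lambda>k. \<Sum>j<r. a j * w j k) = (\<Sum>j<r. a j * l (w j))" if "l \<in> \<Lambda>" for l a w and r :: nat
    using lin[OF that]
    by (auto simp: sum_distrib_left sum_distrib_right mult_ac intro: sum.swap)
  have lin_scale: "l (\<lambda>k. a * w k) = a * l w" if "l \<in> \<Lambda>" for l a w
    using lin[OF that] by (auto simp: sum_distrib_left mult_ac)
  have lin_diff: "l (\<lambda>k. x k - a * w k) = l x - a * l w" if "l \<in> \<Lambda>" for l a x w
    using lin[OF that] by (auto simp: sum_distrib_left sum_subtractf algebra_simps)
  \<comment> \<open>Dual vectors are independent: applying \<open>l i\<close> to a vanishing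
    combination reads off its \<open>i\<close>-th coefficient. So the sizes are bounded by
    \<open>n\<close> and a greatest one exists.\<close>
  have bound: "r \<le> n" if "dual r l w" for r l w
  proof -
    have "cdim {0::nat \<Rightarrow> complex} + r \<le> n"
    proof (rule cdim_add_le)
      fix a assume a: "(\<lambda>k. \<Sum>j<r. a j * w j k) \<in> {0}"
      show "\<forall>j<r. a j = 0"
      proof (intro allI impI)
        fix i assume i: "i < r"
        then have "l i \<in> \<Lambda>" using that by (simp add: dual_def)
        then have "l i (\<lambda>k. \<Sum>j<r. a j * w j k) = (\<Sum>j<r. a j * l i (w j))" by (rule lin_sum)
        also have "\<dots> = (\<Sum>j<r. if j = i then a j else 0)"
          using that i by (intro sum.cong) (auto simp: dual_def)
        also have "\<dots> = a i" using i by simp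
        finally show "a i = 0" using a lin[OF \<open>l i \<in> \<Lambda>\<close>] by auto
      qed
    qed (use that in \<open>auto simp: dual_def cspace_def cvec.subspace_def\<close>)
    then show ?thesis by simp
  qed
  have "dual 0 (\<lambda>_ _. 0) (\<lambda>_ _. 0)" by (simp add: dual_def)
  then have ex: "\<exists>r. \<exists>l w. dual r l w" by blast
  define r where "r = (GREATEST r. \<exists>l w. dual r l w)"
  have "\<exists>l w. dual r l w"
    unfolding r_def using bound by (intro GreatestI_ex_nat[OF ex, of n]) blast
  then obtain l w where d: "dual r l w" by blast
  have max: "r' \<le> r" if "dual r' l w" for r' l w
    unfolding r_def using bound that by (intro Greatest_le_nat[of _ r' n]) blast+
  have "g x = 0" if x: "x \<in> cspace n" "\<And>i. i < r \<Longrightarrow> l i x = 0" and g: "g \<in> \<Lambda>" for x g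
  proof (rule ccontr)
    assume "g x \<noteq> 0"
    \<comment> \<open>If some \<open>g\<close> were nonzero on the common kernel of the
      \<open>l i\<close>, then \<open>x\<close>, rescaled to \<open>g y = 1\<close>, would extend
      the system: \<open>g\<close> is the new functional, and subtracting \<open>g (w j)\<close>
      times \<open>y\<close> from each old \<open>w j\<close> keeps the system dual.\<close>
    define y where "y = (\<lambda>k. (1 / g x) * x k)"
    have scale: "l' y = l' x / g x" if "l' \<in> \<Lambda>" for l'
      unfolding y_def lin_scale[OF that] by simp
    have y: "y \<in> cspace n" "g y = 1" "\<And>i. i < r \<Longrightarrow> l i y = 0"
      using x d scale[of "l _"] scale[OF g] \<open>g x \<noteq> 0\<close>
      by (simp_all add: dual_def) (simp add: y_def cspace_def)
    define l' where "l' = l(r := g)"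
    define w' where "w' j = (if j = r then y else (\<lambda>k. w j k - g (w j) * y k))" for j
    have "l' i \<in> \<Lambda>" "w' i \<in> cspace n" if "i < Suc r" for i
      using that d g y(1) by (auto simp: l'_def w'_def dual_def less_Suc_eq cspace_def)
    moreover have "l' i (w' j) = (if i = j then 1 else 0)" if "i < Suc r" "j < Suc r" for i j
    proof -
      have "l i (\<lambda>k. w j k - g (w j) * y k) = l i (w j) - g (w j) * l i y" if "i < r"
        using d that by (intro lin_diff) (simp add: dual_def)
      then show ?thesis using that d y(2,3) lin_diff[OF g, of "w j" "g (w j)" y]
        by (auto simp: l'_def w'_def dual_def less_Suc_eq)
    qed
    ultimately have "dual (Suc r) l' w'" unfolding dual_def by blast
    then show False using max by fastforce
  qed
  then have "\<forall>x\<in>cspace n. (\<forall>i<r. l i x = 0) \<longrightarrow> (\<forall>g\<in>\<Lambda>. g x = 0)" by blast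
  moreover have "\<forall>i<r. l i \<in> \<Lambda> \<and> w i \<in> cspace n \<and> (\<forall>j<r. l i (w j) = (if i = j then 1 else 0))"
    using d by (simp add: dual_def)
  ultimately show ?thesis by (intro exI conjI)
qed

section \<open>Determinants\<close>

text \<open>Each Leibniz term takes one entry from every row, so degrees that depend only on the row
  add up to the same total in all terms.\<close>

lemma form_fun_det:
  assumes "\<And>i j. i < m \<Longrightarrow> j < m \<Longrightarrow> form_fun n (e i) (F i j)"
  shows "form_fun n (\<Sum>i<m. e i) (\<lambda>u. Determinant.det (mat m m (\<lambda>(i, j). F i j u)))"
proof -
  have "(\<lambda>u. Determinant.det (mat m m (\<lambda>(i, j). F i j u))) =
     (\<lambda>u. \<Sum>p\<in>{p. p permutes {0..<m}}. signof p * (\<Prod>i = 0..<m. F i (p i) u))"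
    by (auto simp: fun_eq_iff Determinant.det_def dest: permutes_in_image intro!: sum.cong prod.cong)
  moreover have "form_fun n (\<Sum>i<m. e i) \<dots>"
    unfolding lessThan_atLeast0
    by (intro form_fun_sum form_fun_cmult form_fun_prod) (auto simp: assms dest: permutes_in_image)
  ultimately show ?thesis by simp
qed

text \<open>Cramer's rule: the matrix maps \<open>a\<close> to a vector that is zero except in its
  last entry, and multiplying by the adjugate and reading the last coordinate gives the formula.
  Later \<open>a\<close> is the velocity of a curve along which the first \<open>m\<close> functions
  vanish.\<close>

lemma det_eq_cofactor_mult:
  fixes F :: "nat \<Rightarrow> nat \<Rightarrow> 'a::comm_ring_1"
  assumes a: "a m = 1" and F: "\<And>i. i < m \<Longrightarrow> (\<Sum>j\<le>m. F i j * a j) = 0"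
  shows "Determinant.det (mat (Suc m) (Suc m) (\<lambda>(i, j). F i j)) =
    Determinant.det (mat m m (\<lambda>(i, j). F i j)) * (\<Sum>j\<le>m. F m j * a j)"
proof -
  let ?A = "mat (Suc m) (Suc m) (\<lambda>(i, j). F i j)" and ?a = "vec (Suc m) a"
  have A: "?A \<in> carrier_mat (Suc m) (Suc m)" by simp
  have "vec_index (?A *\<^sub>v ?a) i = (\<Sum>j\<le>m. F i j * a j)" if "i < Suc m" for i
    using that by (simp add: scalar_prod_def atLeast0LessThan lessThan_Suc_atMost
      del: sum.atLeast0_lessThan_Suc)
  then have Aa: "?A *\<^sub>v ?a = vec (Suc m) (\<lambda>i. if i = m then (\<Sum>j\<le>m. F m j * a j) else 0)"
    using F by (intro eq_vecI) (auto simp: less_Suc_eq)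
  have "Determinant.det ?A = vec_index ((Determinant.det ?A \<cdot>\<^sub>m 1\<^sub>m (Suc m)) *\<^sub>v ?a) m"
    using a by (simp add: scalar_prod_def)
  also have "\<dots> = vec_index (adj_mat ?A *\<^sub>v (?A *\<^sub>v ?a)) m"
    unfolding adj_mat(3)[OF A, symmetric]
    by (subst assoc_mult_mat_vec[OF adj_mat(1)[OF A] A]) simp_all
  also have "\<dots> = cofactor ?A m m * (\<Sum>j\<le>m. F m j * a j)"
    unfolding Aa using adj_mat(1)[OF A] by (simp add: scalar_prod_def adj_mat_def)
  also have "cofactor ?A m m = Determinant.det (mat m m (\<lambda>(i, j). F i j))"
    unfolding cofactor_def mat_delete_def
    by (auto simp: power_add[symmetric] intro!: arg_cong[of _ _ Determinant.det])
  finally show ?thesis .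
qed

section \<open>Implicit curves\<close>

text \<open>Banach iteration with a holomorphic parameter. The contraction factor 1/2 is uniform in
  \<open>t\<close>, so the iterates, holomorphic in \<open>t\<close>, converge uniformly and the
  limit is holomorphic. The last conclusion is uniqueness within radius \<open>\<rho>\<close>; it
  later pins down the end points of a curve.\<close>

lemma holomorphic_fixed_point:
  fixes G :: "complex \<Rightarrow> (nat \<Rightarrow> complex) \<Rightarrow> nat \<Rightarrow> complex" and r :: nat
  defines "N \<equiv> \<lambda>x. \<Sum>j<r. cmod (x j)"
  assumes S: "open S"
    and hol: "\<And>x i. (\<And>j. j < r \<Longrightarrow> (\<lambda>t. x t j) holomorphic_on S) \<Longrightarrow> i < r \<Longrightarrow>
      (\<lambda>t. G t (x t) i) holomorphic_on S"
    and contr: "\<And>t x y. t \<in> S \<Longrightarrow> N x \<le> \<rho> \<Longrightarrow> N y \<le> \<rho> \<Longrightarrow>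
      N (\<lambda>i. G t x i - G t y i) \<le> N (\<lambda>i. x i - y i) / 2"
    and zero: "\<And>t. t \<in> S \<Longrightarrow> N (G t (\<lambda>_. 0)) \<le> \<rho> / 2"
    and "\<rho> \<ge> 0"
  obtains x where "\<And>j. j < r \<Longrightarrow> (\<lambda>t. x t j) holomorphic_on S"
    "\<And>t. t \<in> S \<Longrightarrow> N (x t) \<le> \<rho>"
    "\<And>t i. t \<in> S \<Longrightarrow> i < r \<Longrightarrow> G t (x t) i = x t i"
    "\<And>t y i. t \<in> S \<Longrightarrow> N y \<le> \<rho> \<Longrightarrow> (\<And>i. i < r \<Longrightarrow> G t y i = y i) \<Longrightarrow> i < r \<Longrightarrow> y i = x t i"
proof -
  have N_ge: "cmod (x j) \<le> N x" if "j < r" for x j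
    unfolding N_def using that by (intro member_le_sum) auto
  have N_add: "N (\<lambda>i. x i + y i) \<le> N x + N y" for x y
    unfolding N_def by (auto simp: sum.distrib[symmetric] intro!: sum_mono norm_triangle_ineq)
  define X where "X m t = ((\<lambda>x. G t x) ^^ m) (\<lambda>_. 0)" for m t
  have X_0: "X 0 t = (\<lambda>_. 0)" and X_Suc: "X (Suc m) t = G t (X m t)" for m t
    by (simp_all add: X_def)
  have N_0: "N (\<lambda>_. 0) = 0" by (simp add: N_def)
  \<comment> \<open>\<open>\<rho> / 2\<close> comes from the contraction and
    \<open>\<rho> / 2\<close> from \<open>zero\<close>: the ball of radius \<open>\<rho>\<close> is
    mapped into itself.\<close>
  have N_G: "N (G t x) \<le> \<rho>" if "t \<in> S" "N x \<le> \<rho>" for t x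
    using contr[OF that, of "\<lambda>_. 0"] zero[OF that(1)] that \<open>\<rho> \<ge> 0\<close> N_0
      N_add[of "\<lambda>i. G t x i - G t (\<lambda>_. 0) i" "G t (\<lambda>_. 0)"] by simp
  have X_le: "N (X m t) \<le> \<rho>" if "t \<in> S" for m t
    by (induction m) (simp_all add: X_0 X_Suc N_0 \<open>\<rho> \<ge> 0\<close> N_G that)
  have X_diff: "N (\<lambda>i. X (Suc m) t i - X m t i) \<le> \<rho> * (1/2) ^ m" if "t \<in> S" for m t
  proof (induction m)
    case 0 then show ?case using zero[OF that] \<open>\<rho> \<ge> 0\<close> by (simp add: X_0 X_Suc)
  next
    case (Suc m)
    show ?case using contr[OF that X_le[OF that] X_le[OF that], of "Suc m" m] Suc
      by (simp add: X_Suc)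
  qed
  have X_hol: "j < r \<Longrightarrow> (\<lambda>t. X m t j) holomorphic_on S" for j m
    by (induction m arbitrary: j) (simp_all add: X_0 X_Suc hol)
  \<comment> \<open>The limit is written as a telescoping series so that the Weierstrass M-test with
    majorant \<open>\<rho> * (1/2) ^ m\<close> applies.\<close>
  define x where "x t j = (\<Sum>m. X (Suc m) t j - X m t j)" for t j
  have X_lim: "uniform_limit S (\<lambda>m t. X m t j) (\<lambda>t. x t j) sequentially" if "j < r" for j
  proof -
    have "uniform_limit S (\<lambda>m t. \<Sum>i<m. X (Suc i) t j - X i t j) (\<lambda>t. x t j) sequentially"
      unfolding x_def
    proof (rule Weierstrass_m_test)
      show "cmod (X (Suc m) t j - X m t j) \<le> \<rho> * (1/2) ^ m" if "t \<in> S" for m t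
        using N_ge[OF \<open>j < r\<close>, of "\<lambda>i. X (Suc m) t i - X m t i"] X_diff[OF that, of m] by simp
      show "summable (\<lambda>m. \<rho> * (1/2) ^ m)" by (intro summable_mult summable_geometric) simp
    qed
    moreover have "(\<Sum>i<m. X (Suc i) t j - X i t j) = X m t j" for m t
      using sum_lessThan_telescope[of "\<lambda>i. X i t j" m] by (simp add: X_0)
    ultimately show ?thesis by simp
  qed
  have X_tends: "(\<lambda>m. X m t j) \<longlonglongrightarrow> x t j" if "t \<in> S" "j < r" for t j
    using tendsto_uniform_limitI[OF X_lim] that by blast
  have x_le: "N (x t) \<le> \<rho>" if "t \<in> S" for t
  proof (rule LIMSEQ_le_const2)
    show "(\<lambda>m. N (X m t)) \<longlonglongrightarrow> N (x t)"
      unfolding N_def by (intro tendsto_intros X_tends) (use that in auto)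
  qed (use X_le[OF that] in auto)
  have x_fix: "G t (x t) i = x t i" if t: "t \<in> S" and i: "i < r" for t i
  proof -
    have "(\<lambda>m. N (\<lambda>i. X m t i - x t i) / 2) \<longlonglongrightarrow> N (\<lambda>i. x t i - x t i) / 2"
      unfolding N_def by (intro tendsto_intros X_tends) (use t in auto)
    then have lim: "(\<lambda>m. N (\<lambda>i. X m t i - x t i) / 2) \<longlonglongrightarrow> 0" using N_0 by simp
    have "cmod (G t (X m t) i - G t (x t) i) \<le> N (\<lambda>i. X m t i - x t i) / 2" for m
      using N_ge[OF i, of "\<lambda>i. G t (X m t) i - G t (x t) i"]
        contr[OF t X_le[OF t] x_le[OF t], of m] by linarith
    then have "(\<lambda>m. G t (X m t) i - G t (x t) i) \<longlonglongrightarrow> 0"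
      by (intro Lim_null_comparison[OF _ lim] always_eventually) auto
    then have "(\<lambda>m. X (Suc m) t i) \<longlonglongrightarrow> G t (x t) i" by (simp add: X_Suc LIM_zero_iff)
    moreover have "(\<lambda>m. X (Suc m) t i) \<longlonglongrightarrow> x t i" using X_tends[OF t i] by (rule LIMSEQ_Suc)
    ultimately show ?thesis by (rule LIMSEQ_unique)
  qed
  show ?thesis
  proof (rule that)
    fix j assume j: "j < r"
    show "(\<lambda>t. x t j) holomorphic_on S"
    proof (rule holomorphic_uniform_sequence[OF S X_hol[OF j]])
      fix t assume "t \<in> S"
      then obtain d where "d > 0" "cball t d \<subseteq> S" using S open_contains_cball by blast
      then show "\<exists>d>0. cball t d \<subseteq> S \<and> uniform_limit (cball t d) (\<lambda>m t. X m t j) (\<lambda>t. x t j) sequentially"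
        using uniform_limit_on_subset[OF X_lim[OF j]] by blast
    qed
  next
    show "N (x t) \<le> \<rho>" if "t \<in> S" for t using x_le that .
  next
    show "G t (x t) i = x t i" if "t \<in> S" "i < r" for t i using x_fix that .
  next
    fix t y i assume t: "t \<in> S" and y: "N y \<le> \<rho>" "\<And>i. i < r \<Longrightarrow> G t y i = y i" and i: "i < r"
    have "N (\<lambda>i. G t y i - G t (x t) i) = N (\<lambda>i. y i - x t i)"
      unfolding N_def using y(2) x_fix[OF t] by (intro sum.cong) auto
    then have "N (\<lambda>i. y i - x t i) \<le> 0" using contr[OF t y(1) x_le[OF t]] by simp
    then have "cmod (y i - x t i) \<le> 0" using N_ge[OF i, of "\<lambda>i. y i - x t i"] by linarith
    then show "y i = x t i" by simp
  qed
qed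

text \<open>A holomorphic implicit function theorem along the segment from \<open>v\<close> to \<open>u\<close>: the corrections
  \<open>x\<close> in the directions \<open>w\<close> are the fixed point of a simplified Newton iteration, and they vanish
  at both ends because \<open>v\<close> and \<open>u\<close> are solutions already.\<close>

lemma implicit_curve:
  fixes f :: "nat \<Rightarrow> (nat \<Rightarrow> complex) \<Rightarrow> complex" and w :: "nat \<Rightarrow> nat \<Rightarrow> complex"
  assumes form: "\<And>i. i < r \<Longrightarrow> form_fun n (d i) (f i)"
    and zero: "\<And>i. i < r \<Longrightarrow> f i v = 0"
    and dual: "\<And>i j. i < r \<Longrightarrow> j < r \<Longrightarrow> dir_deriv (f i) v (w j) = (if i = j then 1 else 0)"
    and "\<eta> > 0"
  obtains \<epsilon> where "\<epsilon> > 0" "\<And>u. (\<And>k. k < n \<Longrightarrow> cmod (u k - v k) < \<epsilon>) \<Longrightarrow> (\<And>i. i < r \<Longrightarrow> f i u = 0) \<Longrightarrow>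
    \<exists>x. (\<forall>j<r. (\<lambda>t. x t j) holomorphic_on ball 0 2) \<and> (\<forall>j<r. x 0 j = 0 \<and> x 1 j = 0) \<and>
      (\<forall>t\<in>ball 0 2. (\<forall>i<r. f i (\<lambda>k. v k + t * (u k - v k) + (\<Sum>j<r. x t j * w j k)) = 0) \<and>
        (\<forall>k<n. cmod (t * (u k - v k) + (\<Sum>j<r. x t j * w j k)) < \<eta>))"
proof -
  define N where "N x = (\<Sum>j<r. cmod (x j))" for x :: "nat \<Rightarrow> complex"
  \<comment> \<open>Bound on the deviation of the Jacobian entries from the identity matrix. Since
    \<open>r * B \<le> 1/2\<close>, also for \<open>r = 0\<close>, it yields the contraction factor
    1/2.\<close>
  define B where "B = (1 / (2 * (real r + 1)))"
  have "B > 0" "real r * B \<le> 1 / 2" unfolding B_def by (auto simp: field_simps)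
  define M where "M = 1 + (\<Sum>j<r. \<Sum>k<n. cmod (w j k))"
  have "M > 0" unfolding M_def by (intro add_pos_nonneg sum_nonneg) auto
  have M: "cmod (\<Sum>j<r. x j * w j k) \<le> M * N x" if "k < n" for x k
  proof -
    have w_le: "cmod (w j k) \<le> M" if "j < r" for j
    proof -
      have "cmod (w j k) \<le> (\<Sum>k<n. cmod (w j k))" using \<open>k < n\<close> by (intro member_le_sum) auto
      also have "\<dots> \<le> (\<Sum>j<r. \<Sum>k<n. cmod (w j k))"
        using that by (intro member_le_sum[of j "{..<r}" "\<lambda>j. \<Sum>k<n. cmod (w j k)"]) (auto intro: sum_nonneg)
      finally show ?thesis by (simp add: M_def)
    qed
    have "cmod (\<Sum>j<r. x j * w j k) \<le> (\<Sum>j<r. cmod (x j) * cmod (w j k))"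
      by (rule sum_norm_le) (simp add: norm_mult)
    also have "\<dots> \<le> (\<Sum>j<r. cmod (x j) * M)"
      by (intro sum_mono mult_left_mono w_le) auto
    finally show ?thesis by (simp add: N_def sum_distrib_left mult.commute)
  qed
  have "\<exists>\<delta>>0. \<forall>u. (\<forall>k<n. cmod (u k - v k) < \<delta>) \<longrightarrow>
      (\<forall>a\<in>{..<r} \<times> {..<r}. cmod ((\<lambda>u. dir_deriv (f (fst a)) u (w (snd a))) u -
         (\<lambda>u. dir_deriv (f (fst a)) u (w (snd a))) v) < B)"
    by (rule finite_form_eps_delta[where d = "\<lambda>a. d (fst a) - 1"])
      (use form_fun_dir_deriv[OF form] \<open>B > 0\<close> in auto)
  then obtain \<delta>' where "\<delta>' > 0" and \<delta>': "\<And>u i j. (\<And>k. k < n \<Longrightarrow> cmod (u k - v k) < \<delta>') \<Longrightarrow>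
      i < r \<Longrightarrow> j < r \<Longrightarrow> cmod (dir_deriv (f i) u (w j) - (if i = j then 1 else 0)) < B"
    using dual by auto
  define \<delta> where "\<delta> = min \<eta> \<delta>'"
  have "\<delta> > 0" "\<delta> \<le> \<eta>" "\<delta> \<le> \<delta>'" using \<open>\<eta> > 0\<close> \<open>\<delta>' > 0\<close> by (auto simp: \<delta>_def)
  \<comment> \<open>Corrections of norm at most \<open>\<rho>\<close> displace each coordinate by at
    most \<open>\<delta> / 2\<close>, which leaves \<open>\<delta> / 2\<close> for the motion along
    the segment.\<close>
  define \<rho> where "\<rho> = \<delta> / (2 * M)"
  have "\<rho> > 0" "M * \<rho> = \<delta> / 2" using \<open>\<delta> > 0\<close> \<open>M > 0\<close> by (auto simp: \<rho>_def)
  obtain \<epsilon>' where "\<epsilon>' > 0" and \<epsilon>': "\<And>u i. (\<And>k. k < n \<Longrightarrow> cmod (u k - v k) < \<epsilon>') \<Longrightarrow> i < r \<Longrightarrow>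
      cmod (f i u) < \<rho> * B"
    using finite_form_eps_delta[of "{..<r}" "\<rho> * B" n d f v] form zero \<open>\<rho> > 0\<close> \<open>B > 0\<close> by auto
  \<comment> \<open>The parameter runs through the disc of radius 2, an open set containing 0 and 1;
    so the step \<open>t * (u k - v k)\<close> must stay below \<open>\<delta> / 2\<close> and
    \<open>\<epsilon>'\<close> whenever \<open>cmod t < 2\<close>.\<close>
  define \<epsilon> where "\<epsilon> = min (\<delta> / 4) (\<epsilon>' / 2)"
  have "\<epsilon> > 0" using \<open>\<delta> > 0\<close> \<open>\<epsilon>' > 0\<close> by (simp add: \<epsilon>_def)
  show ?thesis
  proof (rule that[OF \<open>\<epsilon> > 0\<close>])
    fix u assume u: "\<And>k. k < n \<Longrightarrow> cmod (u k - v k) < \<epsilon>" "\<And>i. i < r \<Longrightarrow> f i u = 0"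
    define P where "P t x = (\<lambda>k. v k + t * (u k - v k) + (\<Sum>j<r. x j * w j k))" for t x
    \<comment> \<open>A Newton step in which the Jacobian is replaced by its value at
      \<open>v\<close> in the directions \<open>w\<close>, the identity matrix by
      \<open>dual\<close>. Fixed points are the corrections at which all \<open>f i\<close>
      vanish.\<close>
    define G where "G t x = (\<lambda>i. x i - f i (P t x))" for t x
    have step: "cmod (t * (u k - v k)) < min (\<delta> / 2) \<epsilon>'" if "t \<in> ball 0 2" "k < n" for t k
    proof -
      have "cmod t * cmod (u k - v k) \<le> 2 * cmod (u k - v k)"
        using that by (intro mult_right_mono) auto
      also have "\<dots> < 2 * \<epsilon>" using u(1)[OF that(2)] by simp
      also have "\<dots> \<le> min (\<delta> / 2) \<epsilon>'" by (auto simp: \<epsilon>_def)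
      finally show ?thesis by (simp add: norm_mult)
    qed
    have P_near: "cmod (t * (u k - v k) + (\<Sum>j<r. x j * w j k)) < \<delta>"
      if "t \<in> ball 0 2" "N x \<le> \<rho>" "k < n" for t x k
    proof -
      have "M * N x \<le> M * \<rho>" using that \<open>M > 0\<close> by simp
      then show ?thesis
        using M[OF that(3), of x] step[OF that(1,3)] \<open>M * \<rho> = \<delta> / 2\<close>
          norm_triangle_ineq[of "t * (u k - v k)" "\<Sum>j<r. x j * w j k"] by linarith
    qed
    have contr: "N (\<lambda>i. G t x i - G t y i) \<le> N (\<lambda>i. x i - y i) / 2"
      if t: "t \<in> ball 0 2" and x: "N x \<le> \<rho>" and y: "N y \<le> \<rho>" for t x y
    proof -
      have "cmod (G t x i - G t y i) \<le> B * N (\<lambda>i. x i - y i)" if i: "i < r" for i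
      proof -
        define z where "z \<tau> = (\<lambda>j. y j + \<tau> * (x j - y j))" for \<tau> :: complex
        \<comment> \<open>Up to sign and an additive constant, \<open>h\<close> is the
          \<open>i\<close>-th component of \<open>G\<close> along the segment from \<open>y\<close>
          to \<open>x\<close>. Its derivative involves the Jacobian minus the identity, whose
          entries are bounded by \<open>B\<close>.\<close>
        define h where "h \<tau> = f i (P t (z \<tau>)) - \<tau> * (x i - y i)" for \<tau>
        define h' where "h' \<tau> = (\<Sum>j<r. (x j - y j) * (dir_deriv (f i) (P t (z \<tau>)) (w j) - (if i = j then 1 else 0)))" for \<tau>
        obtain D where D: "\<And>x w. dir_deriv (f i) x w = (\<Sum>k<n. D k x * w k)"
          and chain: "\<And>\<phi> \<phi>' t. (\<And>k. k < n \<Longrightarrow> ((\<lambda>t. \<phi> t k) has_field_derivative \<phi>' k) (at t)) \<Longrightarrow>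
            ((\<lambda>t. f i (\<phi> t)) has_field_derivative dir_deriv (f i) (\<phi> t) \<phi>') (at t)"
          by (rule form_fun_gradient[OF form[OF i]]) blast
        have deriv: "(h has_field_derivative h' \<tau>) (at \<tau>)" for \<tau>
        proof -
          have "((\<lambda>\<tau>. f i (P t (z \<tau>))) has_field_derivative
              dir_deriv (f i) (P t (z \<tau>)) (\<lambda>k. \<Sum>j<r. (x j - y j) * w j k)) (at \<tau>)"
            unfolding P_def z_def by (rule chain) (auto intro!: derivative_eq_intros)
          then have "(h has_field_derivative
              dir_deriv (f i) (P t (z \<tau>)) (\<lambda>k. \<Sum>j<r. (x j - y j) * w j k) - (x i - y i)) (at \<tau>)"
            unfolding h_def by (auto intro!: derivative_eq_intros)
          also have "dir_deriv (f i) (P t (z \<tau>)) (\<lambda>k. \<Sum>j<r. (x j - y j) * w j k) =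
              (\<Sum>j<r. (x j - y j) * dir_deriv (f i) (P t (z \<tau>)) (w j))"
            unfolding D sum_distrib_left by (subst sum.swap) (simp add: mult_ac)
          also have "x i - y i = (\<Sum>j<r. (x j - y j) * (if i = j then 1 else 0))"
            using i by (simp add: if_distrib cong: if_cong)
          finally show ?thesis by (simp add: h'_def sum_subtractf right_diff_distrib)
        qed
        have bound: "cmod (h' \<tau>) \<le> B * N (\<lambda>i. x i - y i)" if \<tau>: "\<tau> \<in> closed_segment 0 1" for \<tau>
        proof -
          obtain s where s: "0 \<le> s" "s \<le> 1" "\<tau> = of_real s"
            using \<tau> by (auto simp: closed_segment_def scaleR_conv_of_real)
          have "N (z \<tau>) \<le> (1 - s) * N y + s * N x"
          proof -
            have "cmod (z \<tau> j) \<le> (1 - s) * cmod (y j) + s * cmod (x j)" for j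
            proof -
              have "z \<tau> j = of_real (1 - s) * y j + of_real s * x j" by (simp add: z_def s algebra_simps)
              then show ?thesis using s norm_triangle_ineq[of "of_real (1 - s) * y j" "of_real s * x j"]
                by (simp add: norm_mult del: of_real_diff)
            qed
            then show ?thesis unfolding N_def by (auto simp: sum_distrib_left sum.distrib[symmetric] intro: sum_mono)
          qed
          also have "\<dots> \<le> \<rho>" using x y s by (intro convex_bound_le) auto
          finally have z: "N (z \<tau>) \<le> \<rho>" .
          have "cmod (dir_deriv (f i) (P t (z \<tau>)) (w j) - (if i = j then 1 else 0)) \<le> B" if "j < r" for j
            using P_near[OF t z] \<open>\<delta> \<le> \<delta>'\<close> by (intro less_imp_le \<delta>' i that) (fastforce simp: P_def)
          then have "cmod (h' \<tau>) \<le> (\<Sum>j<r. cmod (x j - y j) * B)"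
            unfolding h'_def by (intro sum_norm_le) (simp add: norm_mult mult_left_mono)
          then show ?thesis by (simp add: N_def sum_distrib_left mult.commute)
        qed
        have "cmod (h 0 - h 1) \<le> B * N (\<lambda>i. x i - y i) * cmod (0 - 1)"
          by (rule field_differentiable_bound[of "closed_segment 0 1" h h'])
            (use deriv bound in \<open>auto intro: has_field_derivative_at_within\<close>)
        also have "h 0 - h 1 = G t x i - G t y i" by (simp add: h_def G_def z_def)
        finally show ?thesis by simp
      qed
      then have "N (\<lambda>i. G t x i - G t y i) \<le> (\<Sum>i<r. B * N (\<lambda>i. x i - y i))"
        unfolding N_def[of "\<lambda>i. G t x i - G t y i"] by (intro sum_mono) auto
      also have "\<dots> = (real r * B) * N (\<lambda>i. x i - y i)" by simp
      also have "\<dots> \<le> 1 / 2 * N (\<lambda>i. x i - y i)"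
        using \<open>real r * B \<le> 1 / 2\<close> by (intro mult_right_mono) (auto simp: N_def intro: sum_nonneg)
      finally show ?thesis by simp
    qed
    have zero_le: "N (G t (\<lambda>_. 0)) \<le> \<rho> / 2" if t: "t \<in> ball 0 2" for t
    proof -
      have "cmod (f i (P t (\<lambda>_. 0))) \<le> \<rho> * B" if "i < r" for i
        using step[OF t] that by (intro less_imp_le \<epsilon>') (auto simp: P_def)
      then have "N (G t (\<lambda>_. 0)) \<le> (\<Sum>i<r. \<rho> * B)"
        unfolding N_def G_def by (intro sum_mono) auto
      also have "\<dots> = \<rho> * (real r * B)" by simp
      also have "\<dots> \<le> \<rho> * (1 / 2)" using \<open>\<rho> > 0\<close> \<open>real r * B \<le> 1 / 2\<close> by (intro mult_left_mono) auto
      finally show ?thesis by simp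
    qed
    have hol: "(\<lambda>t. G t (x t) i) holomorphic_on ball 0 2"
      if x: "\<And>j. j < r \<Longrightarrow> (\<lambda>t. x t j) holomorphic_on ball 0 2" and i: "i < r" for x i
    proof -
      have "(\<lambda>t. f i (P t (x t))) holomorphic_on ball 0 2"
        by (rule form_fun_holomorphic[OF form[OF i]])
          (auto simp: P_def intro!: holomorphic_intros x)
      then show ?thesis unfolding G_def by (intro holomorphic_intros x i)
    qed
    obtain x where x: "\<And>j. j < r \<Longrightarrow> (\<lambda>t. x t j) holomorphic_on ball 0 2"
      "\<And>t. t \<in> ball 0 2 \<Longrightarrow> N (x t) \<le> \<rho>"
      "\<And>t i. t \<in> ball 0 2 \<Longrightarrow> i < r \<Longrightarrow> G t (x t) i = x t i"
      "\<And>t y i. t \<in> ball 0 2 \<Longrightarrow> N y \<le> \<rho> \<Longrightarrow> (\<And>i. i < r \<Longrightarrow> G t y i = y i) \<Longrightarrow> i < r \<Longrightarrow> y i = x t i"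
      by (rule holomorphic_fixed_point[of "ball 0 2" r G \<rho>, folded N_def])
        (use hol contr zero_le \<open>\<rho> > 0\<close> in auto)
    \<comment> \<open>At \<open>t = 0\<close> and \<open>t = 1\<close> the uncorrected points are
      \<open>v\<close> and \<open>u\<close>, already solutions, so 0 is a fixed point and uniqueness
      applies.\<close>
    have ends: "x t j = 0" if "t = 0 \<or> t = 1" "j < r" for t j
    proof -
      have "P t (\<lambda>_. 0) = (if t = 0 then v else u)" using that by (auto simp: P_def)
      then have "G t (\<lambda>_. 0) i = 0" if "i < r" for i using zero u(2) that by (simp add: G_def)
      then show ?thesis using x(4)[of t "\<lambda>_. 0" j] that \<open>\<rho> > 0\<close> by (auto simp: N_def)
    qed
    show "\<exists>x. (\<forall>j<r. (\<lambda>t. x t j) holomorphic_on ball 0 2) \<and> (\<forall>j<r. x 0 j = 0 \<and> x 1 j = 0) \<and>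
      (\<forall>t\<in>ball 0 2. (\<forall>i<r. f i (\<lambda>k. v k + t * (u k - v k) + (\<Sum>j<r. x t j * w j k)) = 0) \<and>
        (\<forall>k<n. cmod (t * (u k - v k) + (\<Sum>j<r. x t j * w j k)) < \<eta>))"
      using x(1) ends x(3) P_near[OF _ x(2)] \<open>\<delta> \<le> \<eta>\<close>
      by (intro exI[of _ x]) (fastforce simp: G_def P_def)
  qed
qed

section \<open>Local path connectedness of the cone\<close>

lemma cspan_singleton: "cspan {v} = range (\<lambda>c i. c * v i)"
  by (simp add: cvec.span_singleton)

lemma cspan_singleton_eq:
  assumes "u \<in> cspan {v}" "u \<noteq> 0" shows "cspan {u} = cspan {v}"
proof -
  obtain c where u: "u = (\<lambda>i. c * v i)" using assms(1) by (auto simp: cspan_singleton)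
  with assms(2) have "c \<noteq> 0" by auto
  then have "v = (\<lambda>i. (1 / c) * u i)" using u by auto
  then have "v \<in> cspan {u}" unfolding cspan_singleton by (rule image_eqI) simp
  then show ?thesis using assms(1)
    by (intro equalityI cvec.span_minimal) (auto simp: cvec.subspace_span)
qed

section \<open>The affine cone and its homogeneous ideal\<close>

definition proj_cone :: "nat \<Rightarrow> (nat \<Rightarrow> complex) set set \<Rightarrow> (nat \<Rightarrow> complex) set" where
  "proj_cone N X = {u \<in> cspace (Suc N) - {0}. cspan {u} \<in> X}"

text \<open>The homogeneous elements, of all degrees at once, of the ideal of \<open>X\<close>.
  Elements of different degrees need not add up to another element, so dual systems are drawn from
  the mere set of their differentials.\<close>

definition vanishing_forms :: "nat \<Rightarrow> (nat \<Rightarrow> complex) set set \<Rightarrow> ((nat \<Rightarrow> complex) \<Rightarrow> complex) set" where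
  "vanishing_forms N X = {f. (\<exists>d. form_fun (Suc N) d f) \<and> (\<forall>u\<in>proj_cone N X. f u = 0)}"

lemma proj_cone_imp_mem:
  assumes "L \<in> proj_space N" "L \<in> X" "u \<in> L - {0}"
  shows "u \<in> proj_cone N X" "cspan {u} = L"
proof -
  obtain v where v: "L = cspan {v}" "v \<in> cspace (Suc N)" using assms(1) by (auto simp: proj_space_def)
  show "cspan {u} = L" using assms(3) v cspan_singleton_eq by auto
  moreover have "u \<in> cspace (Suc N)" using assms(3) v by (auto simp: cspan_singleton cspace_def)
  ultimately show "u \<in> proj_cone N X" using assms by (simp add: proj_cone_def)
qed

lemma vanishes_on_lines_iff:
  assumes "X \<subseteq> proj_space N"
  shows "(\<forall>L\<in>X. \<forall>u\<in>L - {0}. f u = 0) \<longleftrightarrow> (\<forall>u\<in>proj_cone N X. f u = 0)"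
  using proj_cone_imp_mem(1) assms
  by (auto simp: proj_cone_def cvec.span_base) blast

lemma proj_algebraic_set_subset: "proj_algebraic_set N X \<Longrightarrow> X \<subseteq> proj_space N"
  by (auto simp: proj_algebraic_set_def)

lemma cone_tangent_space_eq:
  assumes "X \<subseteq> proj_space N"
  shows "cone_tangent_space N X v =
    {w \<in> cspace (Suc N). \<forall>f\<in>vanishing_forms N X. dir_deriv f v w = 0}"
  unfolding cone_tangent_space_def vanishing_forms_def vanishes_on_lines_iff[OF assms] by blast

text \<open>The equations that cut out \<open>X\<close> are themselves vanishing forms; by
  homogeneity their vanishing at \<open>u\<close> spreads over the whole line through
  \<open>u\<close>.\<close>

lemma proj_cone_memI:
  assumes X: "proj_algebraic_set N X" and u: "u \<in> cspace (Suc N) - {0}"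
    and f: "\<And>f. f \<in> vanishing_forms N X \<Longrightarrow> f u = 0"
  shows "u \<in> proj_cone N X"
proof -
  obtain S where S: "\<And>f. f \<in> S \<Longrightarrow> \<exists>d. form_fun (Suc N) d f"
    and X_eq: "X = {L \<in> proj_space N. \<forall>f\<in>S. \<forall>v\<in>L - {0}. f v = 0}"
    using X by (auto simp: proj_algebraic_set_def)
  have "f v = 0" if "f \<in> S" and uv: "v \<in> cspan {u} - {0}" for f v
  proof -
    obtain c where v: "v = (\<lambda>i. c * u i)" using uv by (auto simp: cspan_singleton)
    obtain d where d: "form_fun (Suc N) d f" using S \<open>f \<in> S\<close> by blast
    have "f \<in> vanishing_forms N X"
      using d vanishes_on_lines_iff[OF proj_algebraic_set_subset[OF X], of f] \<open>f \<in> S\<close>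
      by (auto simp: vanishing_forms_def X_eq)
    then show ?thesis using f form_fun_scale[OF d] v by simp
  qed
  then show ?thesis using u by (auto simp: proj_cone_def X_eq proj_space_def)
qed

text \<open>The curve of \<open>implicit_curve\<close> stays in the cone. Constancy of the dimension of the tangent
  spaces makes the Jacobian determinant of \<open>f\<close> and a further vanishing form \<open>g\<close> a vanishing form
  again; along the curve it is the derivative of \<open>g\<close> times a unit. By induction all derivatives of
  \<open>g\<close> along the curve vanish at the centre.\<close>

lemma proj_cone_locally_path_connected:
  assumes X: "projective_manifold N X" and v: "v \<in> proj_cone N X"
  obtains \<epsilon> where "\<epsilon> > 0" "\<And>u. u \<in> proj_cone N X \<Longrightarrow> (\<And>k. k \<le> N \<Longrightarrow> cmod (u k - v k) < \<epsilon>) \<Longrightarrow>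
    \<exists>\<phi>. (\<forall>k. continuous_on {0..1::real} (\<lambda>t. \<phi> t k)) \<and> \<phi> 0 = v \<and> \<phi> 1 = u \<and>
      (\<forall>t\<in>{0..1}. \<phi> t \<in> proj_cone N X)"
proof -
  define n where "n = Suc N"
  let ?C = "proj_cone N X" and ?I = "vanishing_forms N X"
  have alg: "proj_algebraic_set N X" using X by (simp add: projective_manifold_def)
  have sub: "X \<subseteq> proj_space N" using proj_algebraic_set_subset[OF alg] .
  define T where "T u = {w \<in> cspace n. \<forall>f\<in>?I. dir_deriv f u w = 0}" for u
  have "\<exists>d. \<forall>u\<in>?C. cdim (T u) = Suc d"
  proof -
    obtain d where "\<forall>L\<in>X. \<forall>u\<in>L - {0}. cdim (T u) = Suc d"
      using X unfolding projective_manifold_def cone_tangent_space_eq[OF sub] T_def n_def by blast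
    then have "\<forall>u\<in>?C. cdim (T u) = Suc d"
      by (auto simp: proj_cone_def cvec.span_base)
    then show ?thesis ..
  qed
  then obtain d where d: "\<And>u. u \<in> ?C \<Longrightarrow> cdim (T u) = Suc d" by blast
  have form: "\<exists>e. form_fun n e f" if "f \<in> ?I" for f
    using that by (auto simp: vanishing_forms_def n_def)
  have T_sub: "cvec.subspace (T u)" for u
  proof -
    have "dir_deriv f u (\<lambda>k. a * x k + b * y k) = a * dir_deriv f u x + b * dir_deriv f u y"
      if f: "f \<in> ?I" for f a b x y
    proof -
      obtain e where "form_fun n e f" using form[OF f] ..
      from dir_deriv_sum[OF this, where A = "{0, 1::nat}" and a = "\<lambda>i. if i = 0 then a else b"
          and w = "\<lambda>i. if i = 0 then x else y" and x = u]
      show ?thesis by simp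
    qed
    note lin = this
    show ?thesis unfolding cvec.subspace_def T_def
      using lin[of _ 0 "\<lambda>_. 0" 0 "\<lambda>_. 0"] lin[of _ 1 _ 1] lin[of _ _ _ 0]
      by (auto simp: cspace_def zero_fun_def plus_fun_def)
  qed
  have lin: "\<exists>c. \<forall>w. l w = (\<Sum>k<n. c k * w k)" if l: "l \<in> (\<lambda>f. dir_deriv f v) ` ?I" for l
  proof -
    obtain f e where "l = dir_deriv f v" "form_fun n e f" using l form by (metis imageE)
    then show ?thesis by (metis form_fun_gradient)
  qed
  obtain r :: nat and l w where lw: "\<forall>i<r. l i \<in> (\<lambda>f. dir_deriv f v) ` ?I \<and> w i \<in> cspace n \<and>
      (\<forall>j<r. l i (w j) = (if i = j then 1 else 0))"
    and max: "\<forall>x\<in>cspace n. (\<forall>i<r. l i x = 0) \<longrightarrow> (\<forall>g\<in>(\<lambda>f. dir_deriv f v) ` ?I. g x = 0)"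
    by (rule maximal_dual_system[of "(\<lambda>f. dir_deriv f v) ` ?I" n, OF lin, THEN exE], assumption)
      (elim exE conjE, rule that)
  then have w: "\<And>i. i < r \<Longrightarrow> w i \<in> cspace n"
    and dual: "\<And>i j. i < r \<Longrightarrow> j < r \<Longrightarrow> l i (w j) = (if i = j then 1 else 0)" by simp_all
  have "\<forall>i\<in>{..<r}. \<exists>g. g \<in> ?I \<and> l i = dir_deriv g v" using lw by auto
  from bchoice[OF this] obtain f where f: "\<And>i. i < r \<Longrightarrow> f i \<in> ?I"
    and lf: "\<And>i. i < r \<Longrightarrow> l i = dir_deriv (f i) v" by auto
  have "\<forall>i\<in>{..<r}. \<exists>e. form_fun n e (f i)" using f form by simp
  from bchoice[OF this] obtain e where e: "\<And>i. i < r \<Longrightarrow> form_fun n (e i) (f i)" by auto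
  \<comment> \<open>By maximality the \<open>l i\<close> cut out \<open>T v\<close>, and subtracting
    the combination of the \<open>w j\<close> with coefficients \<open>l j x\<close> projects any
    \<open>x\<close> into it.\<close>
  have n_le: "n \<le> Suc d + r"
    unfolding d[OF v, symmetric]
  proof (rule le_cdim_add)
    show "T v \<subseteq> cspace n" by (auto simp: T_def)
    fix x assume x: "x \<in> cspace n"
    let ?y = "\<lambda>k. x k - (\<Sum>j<r. l j x * w j k)"
    have y: "?y \<in> cspace n" using x w by (auto simp: cspace_def)
    have "l i ?y = 0" if i: "i < r" for i
    proof -
      have "l i ?y = l i x - (\<Sum>j<r. l j x * l i (w j))"
        using i e[OF i] by (simp add: lf dir_deriv_diff dir_deriv_sum)
      also have "(\<Sum>j<r. l j x * l i (w j)) = (\<Sum>j<r. l j x * (if i = j then 1 else 0))"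
        using i by (intro sum.cong) (auto simp: dual)
      also have "\<dots> = l i x" using i by (simp add: if_distrib cong: if_cong)
      finally show ?thesis by simp
    qed
    then have "?y \<in> T v" using y max by (auto simp: T_def)
    then show "\<exists>a. (\<lambda>k. x k - (\<Sum>j<r. a j * w j k)) \<in> T v"
      by (rule exI[of _ "\<lambda>j. l j x"])
  qed
  \<comment> \<open>The Jacobian determinant of the \<open>f i\<close> and \<open>g\<close> in
    \<open>r + 1\<close> directions \<open>W\<close>, with \<open>g\<close> as the last row.\<close>
  define J where "J g W u = Determinant.det (mat (Suc r) (Suc r)
    (\<lambda>(i, j). dir_deriv (if i < r then f i else g) u (W j)))" for g W u
  have J: "J g W \<in> ?I" if g: "g \<in> ?I" and W: "\<And>j. j \<le> r \<Longrightarrow> W j \<in> cspace n" for g W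
  proof -
    obtain e' where e': "form_fun n e' g" using form g by blast
    have "form_fun n (\<Sum>i<Suc r. (if i < r then e i else e') - 1) (J g W)"
      unfolding J_def using e e'
      by (intro form_fun_det form_fun_dir_deriv) (auto simp: less_Suc_eq)
    moreover have "J g W u = 0" if u: "u \<in> ?C" for u
    proof (rule ccontr)
      let ?F = "\<lambda>i. if i < r then f i else g"
      let ?A = "mat (Suc r) (Suc r) (\<lambda>(i, j). dir_deriv (?F i) u (W j))"
      assume "J g W u \<noteq> 0"
      then have inj: "a = 0\<^sub>v (Suc r)" if "a \<in> carrier_vec (Suc r)" "?A *\<^sub>v a = 0\<^sub>v (Suc r)" for a
        using det_0_iff_vec_prod_zero_field[of ?A "Suc r"] that unfolding J_def by auto
      \<comment> \<open>A combination of the \<open>W j\<close> in \<open>T u\<close> is annihilated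
        by every row, so an invertible matrix makes the \<open>W j\<close> independent modulo
        \<open>T u\<close>. This contradicts \<open>n_le\<close>, since \<open>T u\<close> has the
        same dimension as \<open>T v\<close>: here the constancy of the dimension enters.\<close>
      have "cdim (T u) + Suc r \<le> n"
      proof (rule cdim_add_le[OF T_sub])
        fix a assume a: "(\<lambda>k. \<Sum>j<Suc r. a j * W j k) \<in> T u"
        have comb: "(\<Sum>j<Suc r. a j * dir_deriv (?F i) u (W j)) = 0" if "i < Suc r" for i
        proof -
          have I: "?F i \<in> ?I" using that f g by auto
          then obtain e'' where e'': "form_fun n e'' (?F i)" using form by blast
          have "dir_deriv (?F i) u (\<lambda>k. \<Sum>j<Suc r. a j * W j k) = 0"
            using a I unfolding T_def by (simp only: mem_Collect_eq)
          then show ?thesis unfolding dir_deriv_sum[OF e''] .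
        qed
        have "?A *\<^sub>v vec (Suc r) a = 0\<^sub>v (Suc r)"
        proof (rule eq_vecI)
          fix i assume i: "i < dim_vec (0\<^sub>v (Suc r) :: complex vec)"
          then have "vec_index (?A *\<^sub>v vec (Suc r) a) i = (\<Sum>j<Suc r. dir_deriv (?F i) u (W j) * a j)"
            by (simp add: scalar_prod_def lessThan_atLeast0 del: sum.lessThan_Suc)
          also have "\<dots> = (\<Sum>j<Suc r. a j * dir_deriv (?F i) u (W j))" by (simp only: mult.commute)
          also have "\<dots> = 0" using i by (intro comb) simp
          finally show "vec_index (?A *\<^sub>v vec (Suc r) a) i = vec_index (0\<^sub>v (Suc r)) i" using i by simp
        qed simp
        then have "vec (Suc r) a = 0\<^sub>v (Suc r)" by (rule inj[OF vec_carrier])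
        then show "\<forall>j<Suc r. a j = 0" by (metis index_vec index_zero_vec(1))
      qed (use W in \<open>auto simp: T_def\<close>)
      then show False using n_le d[OF u] by simp
    qed
    ultimately show ?thesis by (auto simp: vanishing_forms_def n_def)
  qed
  have vC: "v \<in> cspace n" "v \<noteq> 0" using v by (auto simp: proj_cone_def n_def)
  \<comment> \<open>A nonzero coordinate of \<open>v\<close>; moving it by less than
    \<open>cmod (v k0)\<close> keeps the curve away from the origin.\<close>
  then obtain k0 where "v k0 \<noteq> 0" by (auto simp: fun_eq_iff)
  then have k0: "k0 < n" "v k0 \<noteq> 0" using vC(1) not_le by (auto simp: cspace_def)
  have zero: "g u = 0" if "g \<in> ?I" "u \<in> ?C" for g u using that by (simp add: vanishing_forms_def)
  have dual': "dir_deriv (f i) v (w j) = (if i = j then 1 else 0)" if "i < r" "j < r" for i j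
    using dual[OF that] lf that by simp
  obtain \<epsilon> where "\<epsilon> > 0" and \<epsilon>: "\<And>u. (\<And>k. k < n \<Longrightarrow> cmod (u k - v k) < \<epsilon>) \<Longrightarrow> (\<And>i. i < r \<Longrightarrow> f i u = 0) \<Longrightarrow>
    \<exists>x. (\<forall>j<r. (\<lambda>t. x t j) holomorphic_on ball 0 2) \<and> (\<forall>j<r. x 0 j = 0 \<and> x 1 j = 0) \<and>
      (\<forall>t\<in>ball 0 2. (\<forall>i<r. f i (\<lambda>k. v k + t * (u k - v k) + (\<Sum>j<r. x t j * w j k)) = 0) \<and>
        (\<forall>k<n. cmod (t * (u k - v k) + (\<Sum>j<r. x t j * w j k)) < cmod (v k0)))"
    by (rule implicit_curve[of r n e f v w "cmod (v k0)"]) (use e zero f v dual' k0 in auto)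
  show ?thesis
  proof (rule that[OF \<open>\<epsilon> > 0\<close>])
    fix u assume u: "u \<in> ?C" "\<And>k. k \<le> N \<Longrightarrow> cmod (u k - v k) < \<epsilon>"
    define B where "B = ball (0::complex) 2"
    obtain x where x: "\<And>j. j < r \<Longrightarrow> (\<lambda>t. x t j) holomorphic_on B"
      and ends: "\<And>j. j < r \<Longrightarrow> x 0 j = 0 \<and> x 1 j = 0"
      and f_zero: "\<And>t i. t \<in> B \<Longrightarrow> i < r \<Longrightarrow> f i (\<lambda>k. v k + t * (u k - v k) + (\<Sum>j<r. x t j * w j k)) = 0"
      and near: "\<And>t k. t \<in> B \<Longrightarrow> k < n \<Longrightarrow> cmod (t * (u k - v k) + (\<Sum>j<r. x t j * w j k)) < cmod (v k0)"
      using \<epsilon>[of u] u zero f unfolding n_def less_Suc_eq_le B_def by blast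
    have B: "open B" "connected B" "0 \<in> B" by (auto simp: B_def)
    define \<phi> where "\<phi> t = (\<lambda>k. v k + t * (u k - v k) + (\<Sum>j<r. x t j * w j k))" for t
    \<comment> \<open>The velocity of the curve is the combination of the \<open>W j\<close> with
      coefficients \<open>a t j\<close>. The direction \<open>u - v\<close> has coefficient 1 and
      comes last, as \<open>det_eq_cofactor_mult\<close> requires.\<close>
    define W where "W j = (if j < r then w j else (\<lambda>k. u k - v k))" for j
    define a where "a t j = (if j < r then deriv (\<lambda>t. x t j) t else 1)" for t j
    have W: "W j \<in> cspace n" for j
      using w u vC by (auto simp: W_def proj_cone_def n_def cspace_def)
    have \<phi>_hol: "(\<lambda>t. \<phi> t k) holomorphic_on B" for k
      unfolding \<phi>_def by (intro holomorphic_intros x) auto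
    have \<phi>_deriv: "((\<lambda>t. \<phi> t k) has_field_derivative (\<Sum>j\<le>r. a t j * W j k)) (at t)" if "t \<in> B" for t k
    proof -
      have "((\<lambda>t. x t j) has_field_derivative deriv (\<lambda>t. x t j) t) (at t)" if "j < r" for j
        by (rule holomorphic_derivI[OF x[OF that] B(1) \<open>t \<in> B\<close>])
      then have "((\<lambda>t. \<phi> t k) has_field_derivative
          (u k - v k) + (\<Sum>j<r. deriv (\<lambda>t. x t j) t * w j k)) (at t)"
        unfolding \<phi>_def by (auto intro!: derivative_eq_intros)
      also have "(u k - v k) + (\<Sum>j<r. deriv (\<lambda>t. x t j) t * w j k) = (\<Sum>j\<le>r. a t j * W j k)"
        by (simp add: a_def W_def lessThan_Suc_atMost[symmetric])
      finally show ?thesis .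
    qed
    have along: "((\<lambda>t. g (\<phi> t)) has_field_derivative (\<Sum>j\<le>r. dir_deriv g (\<phi> t) (W j) * a t j)) (at t)"
      if g: "g \<in> ?I" and t: "t \<in> B" for g t
    proof -
      obtain e' where e': "form_fun n e' g" using form g by blast
      have "((\<lambda>t. g (\<phi> t)) has_field_derivative dir_deriv g (\<phi> t) (\<lambda>k. \<Sum>j\<le>r. a t j * W j k)) (at t)"
        by (rule form_fun_chain[OF e' \<phi>_deriv[OF t]])
      then show ?thesis unfolding dir_deriv_sum[OF e'] by (simp only: mult.commute)
    qed
    \<comment> \<open>The unit factor: the Jacobian determinant of the \<open>f i\<close> alone,
      equal to 1 at \<open>t = 0\<close> and hence nonzero near it.\<close>
    define c where "c t = Determinant.det (mat r r (\<lambda>(i, j). dir_deriv (f i) (\<phi> t) (w j)))" for t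
    have "(\<lambda>t. c t) holomorphic_on B"
      unfolding c_def by (rule form_fun_holomorphic[OF form_fun_det[of r n "\<lambda>i. e i - 1"]])
        (use form_fun_dir_deriv[OF e] \<phi>_hol in auto)
    have \<phi>_0: "\<phi> 0 = v" and \<phi>_1: "\<phi> 1 = u" using ends by (auto simp: \<phi>_def)
    have "mat r r (\<lambda>(i, j). dir_deriv (f i) v (w j)) = 1\<^sub>m r"
      by (rule eq_matI) (auto simp: dual')
    then have "c 0 = 1" by (simp add: c_def \<phi>_0)
    define B' where "B' = {t \<in> B. c t \<noteq> 0}"
    have B': "open B'" "0 \<in> B'" "B' \<subseteq> B"
      using continuous_open_preimage[OF holomorphic_on_imp_continuous_on[OF \<open>c holomorphic_on B\<close>] B(1), of "- {0}"]
        \<open>c 0 = 1\<close> B(3) by (auto simp: B'_def vimage_def Int_def open_Compl)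
    \<comment> \<open>The \<open>f i\<close> vanish along the curve, so the first \<open>r\<close>
      rows annihilate the velocity, while the last row applied to it is the derivative of
      \<open>g\<close>.\<close>
    have J_along: "deriv (\<lambda>t. g (\<phi> t)) t = 1 / c t * J g W (\<phi> t)" if g: "g \<in> ?I" and t: "t \<in> B'" for g t
    proof -
      have tB: "t \<in> B" using t B' by blast
      let ?F = "\<lambda>i j. dir_deriv (if i < r then f i else g) (\<phi> t) (W j)"
      have "J g W (\<phi> t) = Determinant.det (mat r r (\<lambda>(i, j). ?F i j)) * (\<Sum>j\<le>r. ?F r j * a t j)"
        unfolding J_def
      proof (rule det_eq_cofactor_mult)
        fix i assume i: "i < r"
        have "((\<lambda>t. f i (\<phi> t)) has_field_derivative 0) (at t)"
          using has_field_derivative_transform_within_open[OF DERIV_const[of 0] B(1) tB]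
            f_zero[OF _ i] by (simp add: \<phi>_def)
        then have "(\<Sum>j\<le>r. dir_deriv (f i) (\<phi> t) (W j) * a t j) = 0"
          using along[OF f[OF i] tB] DERIV_unique by blast
        then show "(\<Sum>j\<le>r. ?F i j * a t j) = 0" using i by simp
      qed (simp add: a_def)
      also have "mat r r (\<lambda>(i, j). ?F i j) = mat r r (\<lambda>(i, j). dir_deriv (f i) (\<phi> t) (w j))"
        by (rule cong_mat) (auto simp: W_def)
      also have "(\<Sum>j\<le>r. ?F r j * a t j) = deriv (\<lambda>t. g (\<phi> t)) t"
        using DERIV_imp_deriv[OF along[OF g tB]] by simp
      finally show ?thesis using t by (simp add: B'_def c_def)
    qed
    have hol: "(\<lambda>t. g (\<phi> t)) holomorphic_on B" if "g \<in> ?I" for g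
      using form[OF that] form_fun_holomorphic \<phi>_hol by blast
    \<comment> \<open>The induction ranges over all vanishing forms at once: by the Leibniz rule the
      \<open>m\<close>-th derivative of \<open>g\<close> involves lower derivatives of another form,
      \<open>J g W\<close>.\<close>
    have higher: "(deriv ^^ m) (\<lambda>t. g (\<phi> t)) 0 = 0" if "g \<in> ?I" for m g
      using that
    proof (induction m arbitrary: g rule: less_induct)
      case (less m)
      show ?case
      proof (cases m)
        case 0
        then show ?thesis using zero[OF less.prems v] by (simp add: \<phi>_0)
      next
        case (Suc m')
        have JI: "J g W \<in> ?I" using J less.prems W by blast
        have c_hol: "(\<lambda>t. 1 / c t) holomorphic_on B'"
          by (intro holomorphic_intros holomorphic_on_subset[OF \<open>c holomorphic_on B\<close> B'(3)]) (auto simp: B'_def)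
        have J_hol: "(\<lambda>t. J g W (\<phi> t)) holomorphic_on B'"
          using holomorphic_on_subset[OF hol[OF JI] B'(3)] .
        have "(deriv ^^ m) (\<lambda>t. g (\<phi> t)) 0 = (deriv ^^ m') (deriv (\<lambda>t. g (\<phi> t))) 0"
          unfolding Suc funpow_Suc_right by simp
        also have "\<dots> = (deriv ^^ m') (\<lambda>t. 1 / c t * J g W (\<phi> t)) 0"
        proof (rule higher_deriv_transform_within_open[OF _ _ B'(1,2)])
          show "deriv (\<lambda>t. g (\<phi> t)) holomorphic_on B'"
            using holomorphic_deriv[OF hol[OF less.prems] B(1)] B'(3) holomorphic_on_subset by blast
        qed (fact holomorphic_on_mult[OF c_hol J_hol], rule J_along[OF less.prems])
        also have "\<dots> = (\<Sum>i = 0..m'. of_nat (m' choose i) * (deriv ^^ i) (\<lambda>t. 1 / c t) 0 *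
            (deriv ^^ (m' - i)) (\<lambda>t. J g W (\<phi> t)) 0)"
          by (rule higher_deriv_mult[OF c_hol J_hol B'(1,2)])
        also have "\<dots> = 0"
          using less.IH[OF _ JI] Suc by (intro sum.neutral) auto
        finally show ?thesis .
      qed
    qed
    have \<phi>_C: "\<phi> t \<in> ?C" if t: "t \<in> B" for t
    proof (rule proj_cone_memI[OF alg])
      have "\<phi> t \<in> cspace n"
        using u vC w by (auto simp: \<phi>_def cspace_def proj_cone_def n_def intro!: sum.neutral)
      moreover have "\<phi> t k0 \<noteq> 0"
      proof
        assume "\<phi> t k0 = 0"
        then have "t * (u k0 - v k0) + (\<Sum>j<r. x t j * w j k0) = - v k0"
          by (simp add: \<phi>_def add.assoc add_eq_0_iff)
        then show False using near[OF t k0(1)] by simp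
      qed
      ultimately show "\<phi> t \<in> cspace (Suc N) - {0}" by (auto simp: n_def)
    next
      fix g assume g: "g \<in> ?I"
      \<comment> \<open>The identity theorem carries the vanishing from the germ at 0 to the whole
        disc, on which \<open>c\<close> may have zeros.\<close>
      show "g (\<phi> t) = 0"
        by (rule holomorphic_fun_eq_0_on_connected[OF hol[OF g] B(1,2) higher[OF g] B(3) t])
    qed
    show "\<exists>\<phi>. (\<forall>k. continuous_on {0..1::real} (\<lambda>t. \<phi> t k)) \<and> \<phi> 0 = v \<and> \<phi> 1 = u \<and>
      (\<forall>t\<in>{0..1}. \<phi> t \<in> ?C)"
    proof (intro exI[of _ "\<lambda>t. \<phi> (of_real t)"] conjI allI ballI)
      have in_B: "of_real t \<in> B" if "t \<in> {0..1}" for t using that by (simp add: B_def)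
      show "continuous_on {0..1} (\<lambda>t. \<phi> (of_real t) k)" for k
        by (rule continuous_on_compose2[OF holomorphic_on_imp_continuous_on[OF \<phi>_hol]])
          (auto intro: continuous_intros in_B)
      show "\<phi> (of_real t) \<in> ?C" if "t \<in> {0..1}" for t using \<phi>_C in_B that by blast
    qed (simp_all add: \<phi>_0 \<phi>_1)
  qed
qed

section \<open>Path connectedness of projective manifolds\<close>

lemma topspace_proj_topology [simp]: "topspace (proj_topology N) = proj_space N"
proof (rule antisym)
  show "topspace (proj_topology N) \<subseteq> proj_space N"
    using openin_proj_topology[of N "topspace (proj_topology N)"] by simp
  have "{v \<in> cspace (Suc N) - {0}. cspan {v} \<in> proj_space N} = cspace (Suc N) - {0}"
    by (auto simp: proj_space_def)
  then have "openin (proj_topology N) (proj_space N)" unfolding openin_proj_topology by simp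
  then show "proj_space N \<subseteq> topspace (proj_topology N)" by (rule openin_subset)
qed

lemma continuous_map_cspan:
  "continuous_map (top_of_set (cspace (Suc N) - {0})) (proj_topology N) (\<lambda>v. cspan {v})"
  unfolding continuous_map_def by (auto simp: openin_proj_topology) (auto simp: proj_space_def)

text \<open>These are the lines with a representative close to \<open>v\<close>. Their preimage in
  the punctured space is a union over the scalars \<open>c \<noteq> 0\<close> of open sets, those
  where \<open>c * z k\<close> is close to \<open>v k\<close> for all
  \<open>k \<le> N\<close>.\<close>

lemma proj_topology_nbhd:
  fixes v :: "nat \<Rightarrow> complex"
  shows "openin (proj_topology N) {L \<in> proj_space N. \<exists>u\<in>L - {0}. \<forall>k\<le>N. cmod (u k - v k) < \<epsilon>}"
    (is "openin _ ?W")
proof -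
  let ?A = "cspace (Suc N) - {0}"
  define O' where "O' = (\<Union>c\<in>-{0}. \<Inter>k\<in>{..N}. {z::nat \<Rightarrow> complex. cmod (c * z k - v k) < \<epsilon>})"
  have "open O'"
    unfolding O'_def
    by (intro open_UN open_INT ballI open_Collect_less continuous_intros finite_atMost) auto
  moreover have "{z \<in> ?A. cspan {z} \<in> ?W} = ?A \<inter> O'"
  proof (intro equalityI subsetI)
    fix z assume z: "z \<in> {z \<in> ?A. cspan {z} \<in> ?W}"
    then obtain u where u: "u \<in> cspan {z} - {0}" "\<forall>k\<le>N. cmod (u k - v k) < \<epsilon>" by blast
    then obtain c where c: "u = (\<lambda>i. c * z i)" by (auto simp: cspan_singleton)
    with u(1) have "c \<noteq> 0" by (auto simp: zero_fun_def)
    with u(2) c show "z \<in> ?A \<inter> O'" using z by (auto simp: O'_def)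
  next
    fix z assume z: "z \<in> ?A \<inter> O'"
    then obtain c where c: "c \<noteq> 0" "\<forall>k\<le>N. cmod (c * z k - v k) < \<epsilon>" by (auto simp: O'_def)
    then have "(\<lambda>i. c * z i) \<in> cspan {z} - {0}" using z by (auto simp: cspan_singleton fun_eq_iff)
    then show "z \<in> {z \<in> ?A. cspan {z} \<in> ?W}" using z c(2) by (auto simp: proj_space_def)
  qed
  ultimately show ?thesis unfolding openin_proj_topology by (auto simp: openin_open)
qed

lemma pathin_cspan:
  assumes X: "X \<subseteq> proj_space N" and \<phi>: "\<And>k. continuous_on {0..1::real} (\<lambda>t. \<phi> t k)"
    "\<And>t. t \<in> {0..1} \<Longrightarrow> \<phi> t \<in> proj_cone N X"
  shows "pathin (subtopology (proj_topology N) X) (\<lambda>t. cspan {\<phi> t})"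
proof -
  have "continuous_on {0..1} \<phi>" using \<phi>(1) by (rule continuous_on_coordinatewise_then_product)
  then have "continuous_map (top_of_set {0..1}) (top_of_set (cspace (Suc N) - {0})) \<phi>"
    using \<phi>(2) by (auto simp: proj_cone_def)
  from continuous_map_compose[OF this continuous_map_cspan] show ?thesis
    using \<phi>(2) by (auto simp: pathin_def continuous_map_in_subtopology o_def proj_cone_def)
qed

text \<open>Paths in the cone project to \<open>X\<close>, so path components are open. Each is also
  closed, its complement being the union of the others, and a connected \<open>X\<close> has only
  one.\<close>

lemma projective_manifold_path_connected:
  assumes X: "projective_manifold N X" and conn: "connectedin (proj_topology N) X"
  shows "path_connectedin (proj_topology N) X"
proof -
  let ?Y = "subtopology (proj_topology N) X"
  have sub: "X \<subseteq> proj_space N"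
    using X proj_algebraic_set_subset by (auto simp: projective_manifold_def)
  then have top: "topspace ?Y = X" by auto
  have nbhd: "\<exists>U. openin ?Y U \<and> L \<in> U \<and> (\<forall>M\<in>U. path_component_of ?Y L M)" if L: "L \<in> X" for L
  proof -
    obtain v where v: "v \<in> proj_cone N X" "L = cspan {v}"
      using L sub by (auto simp: proj_space_def proj_cone_def)
    obtain \<epsilon> where "\<epsilon> > 0" and \<epsilon>: "\<And>u. u \<in> proj_cone N X \<Longrightarrow> (\<And>k. k \<le> N \<Longrightarrow> cmod (u k - v k) < \<epsilon>) \<Longrightarrow>
      \<exists>\<phi>. (\<forall>k. continuous_on {0..1::real} (\<lambda>t. \<phi> t k)) \<and> \<phi> 0 = v \<and> \<phi> 1 = u \<and>
        (\<forall>t\<in>{0..1}. \<phi> t \<in> proj_cone N X)"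
      by (rule proj_cone_locally_path_connected[OF X v(1)]) blast
    let ?W = "{L \<in> proj_space N. \<exists>u\<in>L - {0}. \<forall>k\<le>N. cmod (u k - v k) < \<epsilon>}"
    show ?thesis
    proof (intro exI[of _ "X \<inter> ?W"] conjI ballI)
      show "openin ?Y (X \<inter> ?W)"
        by (rule openin_subtopology_Int2[OF proj_topology_nbhd])
      have "v \<in> L - {0}" using v by (auto simp: proj_cone_def cvec.span_base)
      moreover have "\<forall>k\<le>N. cmod (v k - v k) < \<epsilon>" using \<open>\<epsilon> > 0\<close> by simp
      ultimately show "L \<in> X \<inter> ?W" using L sub by blast
    next
      fix M assume M: "M \<in> X \<inter> ?W"
      then obtain u where u: "u \<in> M - {0}" "\<And>k. k \<le> N \<Longrightarrow> cmod (u k - v k) < \<epsilon>" by auto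
      have "u \<in> proj_cone N X" "cspan {u} = M"
        using proj_cone_imp_mem[of M N X u] M u(1) by auto
      then obtain \<phi> where \<phi>: "\<And>k. continuous_on {0..1::real} (\<lambda>t. \<phi> t k)"
        "\<And>t. t \<in> {0..1} \<Longrightarrow> \<phi> t \<in> proj_cone N X" and ends: "\<phi> 0 = v" "\<phi> 1 = u"
        using \<epsilon>[OF _ u(2)] by blast
      show "path_component_of ?Y L M"
        unfolding path_component_of_def
        by (rule exI[of _ "\<lambda>t. cspan {\<phi> t}"])
          (use pathin_cspan[OF sub \<phi>] ends v(2) \<open>cspan {u} = M\<close> in simp)
    qed
  qed
  have open_comp: "openin ?Y (path_component_of_set ?Y L)" for L
  proof (subst openin_subopen, intro ballI)
    fix M assume "M \<in> path_component_of_set ?Y L"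
    then have LM: "path_component_of ?Y L M" by simp
    then have "M \<in> X" using path_component_in_topspace[OF LM] top by simp
    from nbhd[OF this] obtain U where U: "openin ?Y U" "M \<in> U" "\<And>M'. M' \<in> U \<Longrightarrow> path_component_of ?Y M M'"
      by blast
    then have "U \<subseteq> path_component_of_set ?Y L" using path_component_of_trans[OF LM] by auto
    with U show "\<exists>U. openin ?Y U \<and> M \<in> U \<and> U \<subseteq> path_component_of_set ?Y L" by blast
  qed
  have "path_component_of ?Y L M" if L: "L \<in> X" and M: "M \<in> X" for L M
  proof -
    let ?P = "path_component_of_set ?Y L"
    have "X - ?P = (\<Union>M\<in>X - ?P. path_component_of_set ?Y M)"
    proof (intro equalityI subsetI)
      fix M assume "M \<in> X - ?P"
      then show "M \<in> (\<Union>M\<in>X - ?P. path_component_of_set ?Y M)"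
        using path_component_of_refl[of ?Y M] top by blast
    next
      fix M assume "M \<in> (\<Union>M\<in>X - ?P. path_component_of_set ?Y M)"
      then obtain M' where M': "M' \<in> X - ?P" "path_component_of ?Y M' M" by auto
      then have "M \<in> X" using path_component_in_topspace[OF M'(2)] top by simp
      moreover have "\<not> path_component_of ?Y L M"
      proof
        assume LM: "path_component_of ?Y L M"
        have "path_component_of ?Y M M'" using M'(2) by (simp add: path_component_of_sym)
        with LM have "path_component_of ?Y L M'" by (rule path_component_of_trans)
        with M'(1) show False by simp
      qed
      ultimately show "M \<in> X - ?P" by simp
    qed
    moreover have "openin ?Y (\<Union>M\<in>X - ?P. path_component_of_set ?Y M)"
      using open_comp by (intro openin_Union) blast
    ultimately have "openin ?Y (X - ?P)" by simp
    moreover have "?P \<subseteq> X" using openin_subset[OF open_comp] top by auto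
    ultimately have "closedin ?Y ?P" unfolding closedin_def top by simp
    moreover have "connected_space ?Y" using conn by (simp add: connectedin_def)
    ultimately have "?P = {} \<or> ?P = X"
      using open_comp unfolding connected_space_clopen_in top by blast
    moreover have "L \<in> ?P" using L top by (simp add: path_component_of_refl)
    ultimately show ?thesis using M by blast
  qed
  then have "path_connected_space ?Y"
    by (simp add: path_connected_space_iff_path_component top)
  then show ?thesis using sub by (simp add: path_connectedin_def)
qed

section \<open>Extending morphisms from the affine to the projective line\<close>

text \<open>The coordinate of the affine line is \<open>v 1 / v 0\<close>, so \<open>v 0 = 0\<close>
  is the point at infinity. If \<open>d\<close> exceeds \<open>degree p\<close>, the form vanishes
  there.\<close>

definition homogenize :: "nat \<Rightarrow> complex poly \<Rightarrow> (nat \<Rightarrow> complex) \<Rightarrow> complex" where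
  "homogenize d p v = (\<Sum>k\<le>d. coeff p k * (v 0 ^ (d - k) * v 1 ^ k))"

lemma form_fun_homogenize: "form_fun (Suc 1) d (homogenize d p)"
proof -
  have "form_fun (Suc 1) d (\<lambda>v. v 0 ^ (d - k) * v 1 ^ k)" if "k \<le> d" for k
    using form_fun_monomial[of "Suc 1" "\<lambda>i. if i = 0 then d - k else if i = 1 then k else 0" d] that
    by simp
  then show ?thesis
    unfolding homogenize_def[abs_def] by (intro form_fun_sum form_fun_cmult) auto
qed

lemma homogenize_finite:
  assumes "v 0 \<noteq> 0" "degree p \<le> d"
  shows "homogenize d p v = v 0 ^ d * poly p (v 1 / v 0)"
proof -
  have "poly p (v 1 / v 0) = (\<Sum>k\<le>d. coeff p k * (v 1 / v 0) ^ k)"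
    using assms(2) by (auto simp: poly_altdef intro!: sum.mono_neutral_left le_degree)
  moreover have "v 0 ^ d * (v 1 / v 0) ^ k = v 0 ^ (d - k) * v 1 ^ k" if "k \<le> d" for k
    using that assms(1) by (simp add: power_diff power_divide)
  ultimately show ?thesis
    unfolding homogenize_def by (auto simp: sum_distrib_left intro!: sum.cong)
qed

lemma homogenize_infinity:
  assumes "v 0 = 0" shows "homogenize d p v = coeff p d * v 1 ^ d"
proof -
  have "homogenize d p v = (\<Sum>k\<in>{d}. coeff p k * (v 0 ^ (d - k) * v 1 ^ k))"
    unfolding homogenize_def using assms by (intro sum.mono_neutral_right) auto
  then show ?thesis by simp
qed

abbreviation line :: "complex \<Rightarrow> nat \<Rightarrow> complex" where
  "line z \<equiv> (\<lambda>i. if i = 0 then z else 0)"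

lemma cspace_1: "cspace 1 = range line"
proof (intro equalityI subsetI)
  fix x assume "x \<in> cspace 1"
  then have "x = line (x 0)" by (auto simp: cspace_def fun_eq_iff)
  then show "x \<in> range line" by blast
qed (auto simp: cspace_def)

lemma continuous_on_line: "continuous_on S line"
proof (rule continuous_on_coordinatewise_then_product)
  show "continuous_on S (\<lambda>z. line z i)" for i by (cases "i = 0") (auto intro: continuous_intros)
qed

lemma poly_fun_line:
  assumes "poly_fun 1 f" obtains p where "\<And>z. f (line z) = poly p z"
proof -
  obtain d c where f: "f = (\<lambda>x. \<Sum>\<alpha> | (\<forall>i\<ge>1. \<alpha> i = 0) \<and> (\<Sum>i<1. \<alpha> i) \<le> d. c \<alpha> * (\<Prod>i<1. x i ^ \<alpha> i))"
    using assms unfolding poly_fun_def by blast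
  have "f (line z) = poly (\<Sum>\<alpha> | (\<forall>i\<ge>1. \<alpha> i = 0) \<and> (\<Sum>i<1. \<alpha> i) \<le> d. monom (c \<alpha>) (\<alpha> 0)) z" for z
    unfolding f poly_sum by (simp add: poly_monom)
  then show ?thesis by (rule that)
qed

lemma proj_coord_cspan:
  assumes "v j \<noteq> 0" shows "proj_coord j (cspan {v}) = (\<lambda>i. v i / v j)"
  unfolding proj_coord_def
proof (rule the_equality)
  show "(\<lambda>i. v i / v j) \<in> cspan {v} \<and> v j / v j = 1"
    using assms by (auto simp: cspan_singleton intro!: image_eqI[of _ _ "1 / v j"])
  fix u assume "u \<in> cspan {v} \<and> u j = 1"
  then obtain c where "u = (\<lambda>i. c * v i)" "c * v j = 1" by (auto simp: cspan_singleton)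
  then show "u = (\<lambda>i. v i / v j)" using assms by (auto simp: field_simps)
qed

lemma proj_chart_cspan:
  assumes "v \<in> cspace (Suc N) - {0}" shows "cspan {v} \<in> proj_chart N j \<longleftrightarrow> v j \<noteq> 0"
  using assms by (auto simp: proj_chart_def proj_space_def cspan_singleton)

lemma cspan_scale:
  assumes "c \<noteq> 0" "\<And>i. u i = c * v i" "\<exists>i. v i \<noteq> 0" shows "cspan {u} = cspan {v}"
  using assms by (intro cspan_singleton_eq) (auto simp: cspan_singleton fun_eq_iff)

text \<open>At infinity the degree \<open>d\<close> of the homogenisation is the maximal degree of the components,
  so that not all of them vanish there.\<close>

lemma affine_line_morphism_extends:
  assumes X: "proj_algebraic_set N X" and F: "affine_morphism 1 (cspace 1) N X F"
  obtains \<phi> where "proj_morphism 1 (proj_space 1) N X \<phi>"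
    "\<And>v. v \<in> cspace 2 \<Longrightarrow> v 0 \<noteq> 0 \<Longrightarrow> \<phi> (cspan {v}) = F (line (v 1 / v 0))"
proof -
  have line_mem: "line z \<in> cspace 1" for z unfolding cspace_1 by (rule rangeI)
  then have F_X: "F (line z) \<in> X" for z using F unfolding affine_morphism_def by blast
  \<comment> \<open>On the line, local representations by polynomials become univariate;
    \<open>h\<close> and \<open>g\<close> depend on the point \<open>z\<close>.\<close>
  have rep: "\<exists>h g. poly h z \<noteq> 0 \<and> (\<forall>t. poly h t \<noteq> 0 \<longrightarrow>
      (\<exists>i\<le>N. poly (g i) t \<noteq> 0) \<and> F (line t) = cspan {\<lambda>i. if i \<le> N then poly (g i) t else 0})" for z
  proof -
    obtain h g where hg: "poly_fun 1 h" "\<forall>i\<le>N. poly_fun 1 (g i)" "h (line z) \<noteq> 0"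
      "\<forall>x\<in>cspace 1. h x \<noteq> 0 \<longrightarrow> (\<exists>i\<le>N. g i x \<noteq> 0) \<and> F x = cspan {\<lambda>i. if i \<le> N then g i x else 0}"
      using F line_mem[of z] unfolding affine_morphism_def by blast
    obtain h' where h': "\<And>t. h (line t) = poly h' t" by (rule poly_fun_line[OF hg(1)]) blast
    have "\<forall>i\<in>{..N}. \<exists>p. \<forall>t. g i (line t) = poly p t"
      using hg(2) by (metis atMost_iff poly_fun_line)
    from bchoice[OF this] obtain g' where g': "\<And>i t. i \<le> N \<Longrightarrow> g i (line t) = poly (g' i) t" by auto
    have eq: "(\<lambda>i. if i \<le> N then g i (line t) else 0) = (\<lambda>i. if i \<le> N then poly (g' i) t else 0)" for t
      using g' by auto
    show ?thesis
    proof (intro exI[of _ h'] exI[of _ g'] conjI allI impI)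
      show "poly h' z \<noteq> 0" using hg(3) h' by simp
      fix t assume "poly h' t \<noteq> 0"
      then have "(\<exists>i\<le>N. g i (line t) \<noteq> 0) \<and> F (line t) = cspan {\<lambda>i. if i \<le> N then g i (line t) else 0}"
        using hg(4) h' line_mem[of t] by auto
      then show "\<exists>i\<le>N. poly (g' i) t \<noteq> 0" "F (line t) = cspan {\<lambda>i. if i \<le> N then poly (g' i) t else 0}"
        unfolding eq using g' by auto
    qed
  qed
  \<comment> \<open>The base point 0 is an arbitrary choice: \<open>h0\<close> is a nonzero
    polynomial, so this one representation is valid outside finitely many points, in particular near
    infinity.\<close>
  obtain h0 g0 where h0: "poly h0 0 \<noteq> 0"
    and g0: "\<And>t. poly h0 t \<noteq> 0 \<Longrightarrow> \<exists>i\<le>N. poly (g0 i) t \<noteq> 0"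
    and F0: "\<And>t. poly h0 t \<noteq> 0 \<Longrightarrow> F (line t) = cspan {\<lambda>i. if i \<le> N then poly (g0 i) t else 0}"
    using rep[of 0] by blast
  define d where "d = Max ((\<lambda>i. degree (g0 i)) ` {..N})"
  have d: "degree (g0 i) \<le> d" if "i \<le> N" for i
    unfolding d_def using that by (intro Max_ge) auto
  define ginf where "ginf = (\<lambda>i. if i \<le> N then coeff (g0 i) d else 0)"
  obtain iinf where iinf: "iinf \<le> N" "coeff (g0 iinf) d \<noteq> 0"
  proof -
    have "d \<in> (\<lambda>i. degree (g0 i)) ` {..N}" unfolding d_def by (intro Max_in) auto
    then obtain i where i: "i \<le> N" "d = degree (g0 i)" by auto
    show ?thesis
    proof (cases "g0 i = 0")
      case False
      then show ?thesis using that[OF i(1)] i(2) by simp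
    next
      \<comment> \<open>A zero polynomial of maximal degree forces \<open>d = 0\<close>. All
        components are then constant, and one of them is nonzero at 0.\<close>
      case True
      then have "d = 0" using i by simp
      then have "degree (g0 i) = 0" if "i \<le> N" for i using d[OF that] by simp
      moreover obtain i' where i': "i' \<le> N" "poly (g0 i') 0 \<noteq> 0" using g0[OF h0] by blast
      ultimately show ?thesis using that[OF i'(1)] \<open>d = 0\<close> by (simp add: poly_0_coeff_0)
    qed
  qed
  define G where "G v = (\<lambda>i. if i \<le> N then homogenize d (g0 i) v else 0)" for v
  \<comment> \<open>Homogenised in its exact degree, \<open>h0\<close> contributes its nonzero
    leading coefficient at infinity, so \<open>H\<close> does not vanish there.\<close>
  define H where "H = homogenize (degree h0) h0"
  have G_finite: "(\<exists>i\<le>N. homogenize d (g0 i) v \<noteq> 0) \<and> F (line (v 1 / v 0)) = cspan {G v}"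
    if "v 0 \<noteq> 0" "H v \<noteq> 0" for v
  proof -
    have h: "poly h0 (v 1 / v 0) \<noteq> 0" using that by (simp add: H_def homogenize_finite)
    obtain i where i: "i \<le> N" "poly (g0 i) (v 1 / v 0) \<noteq> 0" using g0[OF h] by blast
    then have "homogenize d (g0 i) v \<noteq> 0" using that(1) d by (simp add: homogenize_finite)
    moreover have "cspan {G v} = F (line (v 1 / v 0))"
      unfolding F0[OF h] using that(1) d i
      by (intro cspan_scale[of "v 0 ^ d"]) (auto simp: G_def homogenize_finite)
    ultimately show ?thesis using i by auto
  qed
  \<comment> \<open>The points with homogeneous coordinates \<open>(t, 1)\<close> approach infinity
    as \<open>t\<close> tends to 0. Their images \<open>G (v t)\<close> lie in the cone for small
    nonzero \<open>t\<close> and converge to \<open>ginf\<close>, so by continuity every vanishing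
    form is zero at \<open>ginf\<close>.\<close>
  have ginf: "ginf \<in> proj_cone N X"
  proof (rule proj_cone_memI[OF X])
    show "ginf \<in> cspace (Suc N) - {0}" using iinf by (auto simp: ginf_def cspace_def fun_eq_iff)
  next
    fix f assume f: "f \<in> vanishing_forms N X"
    then obtain e where e: "form_fun (Suc N) e f" by (auto simp: vanishing_forms_def)
    define v where "v t = (\<lambda>i::nat. if i = 0 then t else if i = 1 then 1 else (0::complex))" for t
    have v_lim: "((\<lambda>t. v t k) \<longlongrightarrow> v 0 k) (at 0)" for k
      unfolding v_def by (cases "k = 0") (auto intro: tendsto_intros)
    have hom_lim: "((\<lambda>t. homogenize d p (v t)) \<longlongrightarrow> homogenize d p (v 0)) (at 0)" for d p
      by (rule form_fun_tendsto[OF form_fun_homogenize v_lim])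
    have "((\<lambda>t. G (v t) k) \<longlongrightarrow> ginf k) (at 0)" for k
      using hom_lim[of d "g0 k"] by (auto simp: G_def ginf_def homogenize_infinity v_def)
    then have "((\<lambda>t. f (G (v t))) \<longlongrightarrow> f ginf) (at 0)" by (rule form_fun_tendsto[OF e])
    moreover have "H (v 0) \<noteq> 0" using h0 by (auto simp: H_def homogenize_infinity v_def)
    then have "\<forall>\<^sub>F t in at 0. H (v t) \<noteq> 0"
      unfolding H_def by (intro tendsto_imp_eventually_ne[OF hom_lim]) 
    then have "\<forall>\<^sub>F t in at 0. f (G (v t)) = 0"
      using eventually_neq_at_within[of 0 0 UNIV]
    proof eventually_elim
      case (elim t)
      then have "v t 0 \<noteq> 0" by (simp add: v_def)
      from G_finite[OF this elim(1)] have "G (v t) \<noteq> 0" "cspan {G (v t)} \<in> X"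
        using F_X by (auto simp: G_def fun_eq_iff) metis
      then have "G (v t) \<in> proj_cone N X" by (auto simp: proj_cone_def G_def cspace_def)
      then show ?case using f by (auto simp: vanishing_forms_def)
    qed
    then have "((\<lambda>t. f (G (v t))) \<longlongrightarrow> 0) (at 0)" by (rule tendsto_eventually)
    ultimately show "f ginf = 0" by (rule tendsto_unique[OF at_neq_bot])
  qed
  define \<phi> where "\<phi> L = (if L \<in> proj_chart 1 0 then F (line (proj_coord 0 L 1)) else cspan {ginf})" for L
  have \<phi>_eq: "\<phi> (cspan {v}) = (if v 0 \<noteq> 0 then F (line (v 1 / v 0)) else cspan {ginf})"
    if "v \<in> cspace (Suc 1) - {0}" for v
    unfolding \<phi>_def proj_chart_cspan[OF that] by (simp add: proj_coord_cspan cong: if_cong)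
  show ?thesis
  proof (rule that[of \<phi>])
    fix v assume "v \<in> cspace 2" "v 0 \<noteq> 0"
    then show "\<phi> (cspan {v}) = F (line (v 1 / v 0))" by (subst \<phi>_eq) (auto simp: numeral_2_eq_2)
  next
    show "proj_morphism 1 (proj_space 1) N X \<phi>"
      unfolding proj_morphism_def
    proof (intro conjI ballI)
      show "\<phi> ` proj_space 1 \<subseteq> X"
        unfolding \<phi>_def using F_X ginf by (auto simp: proj_cone_def)
    next
      fix P assume "P \<in> proj_space 1"
      then obtain v where v: "P = cspan {v}" "v \<in> cspace (Suc 1) - {0}" by (auto simp: proj_space_def)
      show "\<exists>e d h g. form_fun (Suc 1) e h \<and> (\<forall>i\<le>N. form_fun (Suc 1) d (g i)) \<and>
         (\<forall>v\<in>P - {0}. h v \<noteq> 0) \<and>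
         (\<forall>v \<in> cspace (Suc 1) - {0}. cspan {v} \<in> proj_space 1 \<and> h v \<noteq> 0 \<longrightarrow>
            (\<exists>i\<le>N. g i v \<noteq> 0) \<and> \<phi> (cspan {v}) = cspan {\<lambda>i. if i \<le> N then g i v else 0})"
      proof (cases "v 0 = 0")
        \<comment> \<open>At infinity \<open>H\<close> and the homogenised \<open>g0\<close> give
          the representation; at the finite points of its domain it agrees with \<open>F\<close> by
          \<open>G_finite\<close>.\<close>
        case True
        show ?thesis
        proof (rule exI[of _ "degree h0"], rule exI[of _ d], rule exI[of _ H],
            rule exI[of _ "\<lambda>i. homogenize d (g0 i)"], intro conjI allI impI ballI)
          show "form_fun (Suc 1) (degree h0) H" unfolding H_def by (rule form_fun_homogenize)
          show "form_fun (Suc 1) d (homogenize d (g0 i))" for i by (rule form_fun_homogenize)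
        next
          fix u assume "u \<in> P - {0}"
          then obtain c where c: "u = (\<lambda>i. c * v i)" "u \<noteq> 0" using v by (auto simp: cspan_singleton)
          have "u 0 = 0" using c True by simp
          moreover have "u 1 \<noteq> 0"
          proof
            assume "u 1 = 0"
            then have "u i = 0" for i
              using c True v(2) by (cases i; cases "i - 1") (auto simp: cspace_def)
            then show False using c(2) by auto
          qed
          ultimately show "H u \<noteq> 0" using h0 by (auto simp: H_def homogenize_infinity)
        next
          fix u assume u: "u \<in> cspace (Suc 1) - {0}" "cspan {u} \<in> proj_space 1 \<and> H u \<noteq> 0"
          have "(\<exists>i\<le>N. homogenize d (g0 i) u \<noteq> 0) \<and> \<phi> (cspan {u}) = cspan {G u}"
          proof (cases "u 0 = 0")
            case False
            then show ?thesis using G_finite[of u] u by (simp add: \<phi>_eq)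
          next
            case u0: True
            have "u 1 \<noteq> 0"
            proof
              assume "u 1 = 0"
              then have "u i = 0" for i
                using u0 u(1) by (cases i; cases "i - 1") (auto simp: cspace_def)
              then show False using u(1) by auto
            qed
            then have "cspan {G u} = cspan {ginf}"
              using u0 iinf
              by (intro cspan_scale[of "u 1 ^ d"]) (auto simp: G_def ginf_def homogenize_infinity)
            moreover have "homogenize d (g0 iinf) u \<noteq> 0"
              using iinf u0 \<open>u 1 \<noteq> 0\<close> by (simp add: homogenize_infinity)
            ultimately show ?thesis using iinf u u0 by (auto simp: \<phi>_eq)
          qed
          then show "\<exists>i\<le>N. homogenize d (g0 i) u \<noteq> 0"
            "\<phi> (cspan {u}) = cspan {\<lambda>i. if i \<le> N then homogenize d (g0 i) u else 0}"
            by (auto simp: G_def)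
        qed
      next
        case False
        define z where "z = v 1 / v 0"
        obtain h g where h: "poly h z \<noteq> 0"
          and g: "\<And>t. poly h t \<noteq> 0 \<Longrightarrow> \<exists>i\<le>N. poly (g i) t \<noteq> 0"
          and Fz: "\<And>t. poly h t \<noteq> 0 \<Longrightarrow> F (line t) = cspan {\<lambda>i. if i \<le> N then poly (g i) t else 0}"
          using rep[of z] by blast
        \<comment> \<open>Any common bound of the degrees serves here: the neighbourhood chosen
          below avoids infinity, the only point where raising the degree could create a common
          zero.\<close>
        define e where "e = (\<Sum>i\<le>N. degree (g i))"
        have e: "degree (g i) \<le> e" if "i \<le> N" for i
          unfolding e_def using that by (intro member_le_sum) auto
        show ?thesis
        \<comment> \<open>\<open>homogenize 1 1 v\<close> is \<open>v 0\<close>, the constant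
          polynomial 1 homogenised in degree 1; this factor removes the point at infinity from the
          neighbourhood.\<close>
        proof (rule exI[of _ "1 + degree h"], rule exI[of _ e],
            rule exI[of _ "\<lambda>v. homogenize 1 1 v * homogenize (degree h) h v"],
            rule exI[of _ "\<lambda>i. homogenize e (g i)"], intro conjI allI impI ballI)
          show "form_fun (Suc 1) (1 + degree h) (\<lambda>v. homogenize 1 1 v * homogenize (degree h) h v)"
            by (intro form_fun_mult form_fun_homogenize)
          show "form_fun (Suc 1) e (homogenize e (g i))" for i by (rule form_fun_homogenize)
        next
          fix u assume "u \<in> P - {0}"
          then obtain c where "u = (\<lambda>i. c * v i)" "u \<noteq> 0" using v by (auto simp: cspan_singleton)
          then have "u 0 \<noteq> 0" "u 1 / u 0 = z" using False by (auto simp: z_def)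
          then show "homogenize 1 1 u * homogenize (degree h) h u \<noteq> 0"
            using h by (simp add: homogenize_finite del: One_nat_def)
        next
          fix u assume u: "u \<in> cspace (Suc 1) - {0}"
            "cspan {u} \<in> proj_space 1 \<and> homogenize 1 1 u * homogenize (degree h) h u \<noteq> 0"
          have u0: "u 0 \<noteq> 0"
          proof
            assume "u 0 = 0"
            then have "homogenize 1 1 u = 0" by (simp add: homogenize_infinity del: One_nat_def)
            then show False using u(2) by simp
          qed
          then have h: "poly h (u 1 / u 0) \<noteq> 0" using u(2) by (auto simp: homogenize_finite)
          obtain i where i: "i \<le> N" "poly (g i) (u 1 / u 0) \<noteq> 0" using g[OF h] by blast
          then have "homogenize e (g i) u \<noteq> 0" using u0 e by (simp add: homogenize_finite)
          then show "\<exists>i\<le>N. homogenize e (g i) u \<noteq> 0" using i by blast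
          have "cspan {\<lambda>i. if i \<le> N then homogenize e (g i) u else 0} = F (line (u 1 / u 0))"
            unfolding Fz[OF h] using u0 e i
            by (intro cspan_scale[of "u 0 ^ e"]) (auto simp: homogenize_finite)
          then show "\<phi> (cspan {u}) = cspan {\<lambda>i. if i \<le> N then homogenize e (g i) u else 0}"
            using \<phi>_eq[OF u(1)] u0 by simp
        qed
      qed
    qed
  qed
qed

section \<open>The affine line as an affine Riemann surface\<close>

lemma affine_riemann_surface_line: "affine_riemann_surface 1 (cspace 1)"
  unfolding affine_riemann_surface_def
proof (intro conjI ballI)
  show "affine_algebraic_set 1 (cspace 1)"
    unfolding affine_algebraic_set_def by (rule exI[of _ "{}"]) simp
  show "cspace 1 \<noteq> {}" unfolding cspace_1 by simp
  show "connected (cspace 1)"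
    unfolding cspace_1 by (intro connected_continuous_image continuous_on_line connected_UNIV)
next
  fix x :: "nat \<Rightarrow> complex" assume x: "x \<in> cspace 1"
  \<comment> \<open>A function vanishing on the whole line has zero derivative in all its
    directions, so the tangent space is the full \<open>cspace 1\<close>.\<close>
  have "dir_deriv f x w = 0" if "w \<in> cspace 1" "\<forall>y\<in>cspace 1. f y = 0" for f w
  proof -
    have "(\<lambda>i. x i + t * w i) \<in> cspace 1" for t using x that(1) by (simp add: cspace_def)
    then have "(\<lambda>t. f (\<lambda>i. x i + t * w i)) = (\<lambda>t. 0)" using that(2) by blast
    then show ?thesis by (simp add: dir_deriv_def)
  qed
  then have eq: "affine_tangent_space 1 (cspace 1) x = cspace 1"
    unfolding affine_tangent_space_def by blast
  show "cdim (affine_tangent_space 1 (cspace 1) x) = 1"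
    unfolding eq
  proof (rule cvec.dim_unique[of "{line 1}"])
    show "cvec.independent {line 1}"
      by (auto simp: cvec.independent_insert cvec.independent_empty fun_eq_iff)
    show "cspace 1 \<subseteq> cspan {line 1}"
    proof
      fix x assume "x \<in> cspace 1"
      then obtain z where "x = line z" unfolding cspace_1 by blast
      then show "x \<in> cspan {line 1}" unfolding cspan_singleton by (intro image_eqI[of _ _ z]) auto
    qed
  qed (auto simp: cspace_def)
qed

text \<open>The plane without two points is connected and unbounded, so its only component has
  noncompact closure.\<close>

lemma runge_compact_two_points: "runge_compact (cspace 1) {line 0, line 1}"
  unfolding runge_compact_def
proof (intro conjI ballI notI)
  show "compact {line 0, line 1}" by (intro finite_imp_compact) simp
  show "{line 0, line 1} \<subseteq> cspace 1" unfolding cspace_1 by blast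
next
  let ?S = "cspace 1 - {line 0, line 1}"
  have "inj line" by (auto simp: inj_def fun_eq_iff)
  then have S: "?S = line ` (UNIV - {0, 1})"
    unfolding cspace_1 by (simp add: image_set_diff)
  have "connected (UNIV - {0, 1 :: complex})"
    by (rule connected_open_delete_finite) auto
  then have "connected ?S"
    unfolding S by (rule connected_continuous_image[OF continuous_on_line])
  fix C assume "C \<in> components ?S" and comp: "compact (cspace 1 \<inter> closure C)"
  with \<open>connected ?S\<close> have "C = ?S" using connected_eq_components_subset_sing by blast
  have "compact ((\<lambda>x. x 0) ` (cspace 1 \<inter> closure C))"
    by (rule compact_continuous_image[OF continuous_on_subset[OF continuous_on_product_coordinates] comp]) simp
  then have "bounded ((\<lambda>x. x 0) ` (cspace 1 \<inter> closure C))" by (rule compact_imp_bounded)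
  moreover have "UNIV - {0, 1} \<subseteq> (\<lambda>x. x 0) ` (cspace 1 \<inter> closure C)"
  proof
    fix z :: complex assume "z \<in> UNIV - {0, 1}"
    then have "line z \<in> C" unfolding \<open>C = ?S\<close> S by blast
    moreover have "line z \<in> cspace 1" unfolding cspace_1 by blast
    ultimately have "line z \<in> cspace 1 \<inter> closure C" using closure_subset by blast
    then show "z \<in> (\<lambda>x. x 0) ` (cspace 1 \<inter> closure C)" by (intro image_eqI[of _ _ "line z"]) auto
  qed
  ultimately have "bounded (UNIV - {0, 1 :: complex})" by (rule bounded_subset)
  then have "bounded ((UNIV - {0, 1 :: complex}) \<union> {0, 1})" by (simp only: bounded_Un) auto
  moreover have "(UNIV - {0, 1 :: complex}) \<union> {0, 1} = UNIV" by blast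
  ultimately show False using not_bounded_UNIV by metis
qed

text \<open>A map that is constant near each of the two points is holomorphic there, so any path from
  \<open>p\<close> to \<open>q\<close>, extended to the plane, is admissible in the definition of \<open>aOka1\<close>.\<close>

lemma two_valued_map_holomorphic:
  assumes cont: "continuous_map (top_of_set R) (proj_topology N) f"
    and U: "U \<subseteq> R" "open U1" "open U2" "U \<subseteq> U1 \<union> U2"
    and f: "\<And>x. x \<in> U \<inter> U1 \<Longrightarrow> f x = p" "\<And>x. x \<in> U \<inter> U2 \<Longrightarrow> f x = q"
  shows "holomorphic_map_on n R N U f"
  unfolding holomorphic_map_on_def holomorphic_curve_def
proof (intro allI impI conjI)
  fix V \<gamma> assume \<gamma>: "local_param n R V \<gamma> \<and> \<gamma> ` V \<subseteq> U"
  then have V: "open V" and \<gamma>_cont: "continuous_on V \<gamma>"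
    by (auto simp: local_param_def homeomorphism_def)
  show "continuous_map (top_of_set V) (proj_topology N) (f \<circ> \<gamma>)"
    by (rule continuous_map_compose[OF _ cont]) (use \<gamma>_cont \<gamma> U(1) in auto)
  fix j i
  define V1 where "V1 = V \<inter> \<gamma> -` U1"
  define V2 where "V2 = V \<inter> \<gamma> -` U2"
  have "open V1" "open V2"
    unfolding V1_def V2_def using continuous_open_preimage[OF \<gamma>_cont V] U(2,3) by blast+
  have f_V: "(f \<circ> \<gamma>) z = p" if "z \<in> V1" for z
    unfolding o_apply by (rule f(1)) (use \<gamma> that in \<open>auto simp: V1_def\<close>)
  have "(\<lambda>z. proj_coord j ((f \<circ> \<gamma>) z) i) holomorphic_on V1"
    by (rule holomorphic_transform[OF holomorphic_on_const[of "proj_coord j p i"]]) (simp only: f_V)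
  moreover have f_V: "(f \<circ> \<gamma>) z = q" if "z \<in> V2" for z
    unfolding o_apply by (rule f(2)) (use \<gamma> that in \<open>auto simp: V2_def\<close>)
  have "(\<lambda>z. proj_coord j ((f \<circ> \<gamma>) z) i) holomorphic_on V2"
    by (rule holomorphic_transform[OF holomorphic_on_const[of "proj_coord j q i"]]) (simp only: f_V)
  ultimately have "(\<lambda>z. proj_coord j ((f \<circ> \<gamma>) z) i) holomorphic_on V1 \<union> V2"
    using \<open>open V1\<close> \<open>open V2\<close> by (rule holomorphic_on_Un)
  then show "(\<lambda>z. proj_coord j ((f \<circ> \<gamma>) z) i) holomorphic_on {z \<in> V. (f \<circ> \<gamma>) z \<in> proj_chart N j}"
    by (rule holomorphic_on_subset) (use \<gamma> U(4) in \<open>auto simp: V1_def V2_def\<close>)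
qed

lemma path_extends_to_line:
  assumes "pathin Y \<gamma>"
  obtains f where "continuous_map (top_of_set (cspace 1)) Y f"
    "\<And>x. Re (x 0) < 1/3 \<Longrightarrow> f x = \<gamma> 0" "\<And>x. Re (x 0) > 2/3 \<Longrightarrow> f x = \<gamma> 1"
proof
  \<comment> \<open>A clamped affine function of the real part: 0 up to 1/3 and 1 from 2/3 on, so
    that the path is traversed in the strip between and the map is constant on either side.\<close>
  define s where "s x = max 0 (min 1 (3 * Re (x 0) - 1))" for x :: "nat \<Rightarrow> complex"
  have "continuous_on (cspace 1) s"
    unfolding s_def
    by (intro continuous_intros continuous_on_subset[OF continuous_on_product_coordinates]) simp
  then have "continuous_map (top_of_set (cspace 1)) (top_of_set {0..1}) s"
    by (auto simp: s_def)
  from continuous_map_compose[OF this assms[unfolded pathin_def]]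
  show "continuous_map (top_of_set (cspace 1)) Y (\<gamma> \<circ> s)" .
  show "(\<gamma> \<circ> s) x = \<gamma> 0" if "Re (x 0) < 1/3" for x
  proof -
    have "s x = 0" using that by (simp add: s_def)
    then show ?thesis by simp
  qed
  show "(\<gamma> \<circ> s) x = \<gamma> 1" if "Re (x 0) > 2/3" for x
  proof -
    have "s x = 1" using that by (simp add: s_def)
    then show ?thesis by simp
  qed
qed

section \<open>Rational connectedness\<close>

theorem proposition1p7:
  fixes N :: nat and X :: "(nat \<Rightarrow> complex) set set"
  assumes "projective_manifold N X"
    and "connectedin (proj_topology N) X"
    and "aOka1 N X"
  shows "rationally_connected N X"
  unfolding rationally_connected_def
proof (intro ballI)
  fix p q assume p: "p \<in> X" and q: "q \<in> X"
  let ?Y = "subtopology (proj_topology N) X" and ?K = "{line 0, line 1}"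
  have alg: "proj_algebraic_set N X" using assms(1) by (simp add: projective_manifold_def)
  have "path_connected_space ?Y" "topspace ?Y = X"
    using projective_manifold_path_connected[OF assms(1,2)]
    by (auto simp: path_connectedin_def topspace_subtopology)
  then have "\<exists>\<gamma>. pathin ?Y \<gamma> \<and> \<gamma> 0 = p \<and> \<gamma> 1 = q"
    using p q by (simp only: path_connected_space_def)
  then obtain \<gamma> where \<gamma>: "pathin ?Y \<gamma>" "\<gamma> 0 = p" "\<gamma> 1 = q" by blast
  obtain f where f: "continuous_map (top_of_set (cspace 1)) ?Y f"
    "\<And>x. Re (x 0) < 1/3 \<Longrightarrow> f x = p" "\<And>x. Re (x 0) > 2/3 \<Longrightarrow> f x = q"
    by (rule path_extends_to_line[OF \<gamma>(1), unfolded \<gamma>(2,3)]) blast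
  define U1 where "U1 = {x :: nat \<Rightarrow> complex. Re (x 0) < 1/3}"
  define U2 where "U2 = {x :: nat \<Rightarrow> complex. Re (x 0) > 2/3}"
  have U: "open U1" "open U2"
    unfolding U1_def U2_def by (auto intro!: open_Collect_less continuous_intros)
  have "holomorphic_map_on 1 (cspace 1) N (cspace 1 \<inter> (U1 \<union> U2)) f"
    by (rule two_valued_map_holomorphic[of _ _ _ _ U1 U2 p q])
      (use f U in \<open>auto simp: U1_def U2_def continuous_map_in_subtopology\<close>)
  moreover have "openin (top_of_set (cspace 1)) (cspace 1 \<inter> (U1 \<union> U2))"
    using U by (intro openin_open_Int open_Un)
  moreover have K_sub: "?K \<subseteq> cspace 1" unfolding cspace_1 by blast
  then have "?K \<subseteq> cspace 1 \<inter> (U1 \<union> U2)" by (auto simp: U1_def U2_def)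
  ultimately have U_ex: "\<exists>U. openin (top_of_set (cspace 1)) U \<and> ?K \<subseteq> U \<and> holomorphic_map_on 1 (cspace 1) N U f"
    by blast
  have "\<exists>F. affine_morphism 1 (cspace 1) N X F \<and> (\<forall>x\<in>?K. agree_to_order 1 (cspace 1) N 1 x F f)"
  proof -
    obtain dist\<^sub>X where oka: "\<And>n R K A f (\<epsilon>::real) (k::nat).
        affine_riemann_surface n R \<and> runge_compact R K \<and> finite A \<and> A \<subseteq> K \<and>
        continuous_map (top_of_set R) ?Y f \<and>
        (\<exists>U. openin (top_of_set R) U \<and> K \<subseteq> U \<and> holomorphic_map_on n R N U f) \<and>
        \<epsilon> > 0 \<and> k \<ge> 1 \<Longrightarrow>
        (\<exists>F. affine_morphism n R N X F \<and> homotopic_with (\<lambda>_. True) (top_of_set R) ?Y f F \<and>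
           (\<forall>p\<in>K. dist\<^sub>X (F p) (f p) < \<epsilon>) \<and> (\<forall>p\<in>A. agree_to_order n R N k p F f))"
      using assms(3) unfolding aOka1_def by blast
    \<comment> \<open>Taking \<open>A = K\<close> forces \<open>F\<close> to agree with
      \<open>f\<close> at both points exactly; \<open>\<epsilon> = 1\<close> and order 1 are
      arbitrary admissible values.\<close>
    show ?thesis
      using oka[of 1 "cspace 1" ?K ?K f 1 1] affine_riemann_surface_line runge_compact_two_points f(1) U_ex
      by auto
  qed
  then obtain F where F: "affine_morphism 1 (cspace 1) N X F"
    and agree: "\<And>x. x \<in> ?K \<Longrightarrow> agree_to_order 1 (cspace 1) N 1 x F f" by blast
  have "F (line 0) = p" "F (line 1) = q"
    using agree[of "line 0"] agree[of "line 1"] f(2)[of "line 0"] f(3)[of "line 1"]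
    by (simp_all add: agree_to_order_def)
  obtain \<phi> where \<phi>: "proj_morphism 1 (proj_space 1) N X \<phi>"
    "\<And>v. v \<in> cspace 2 \<Longrightarrow> v 0 \<noteq> 0 \<Longrightarrow> \<phi> (cspan {v}) = F (line (v 1 / v 0))"
    by (rule affine_line_morphism_extends[OF alg F]) blast
  \<comment> \<open>Homogeneous coordinates of the point \<open>z\<close> of the affine
    line.\<close>
  define v where "v z = (\<lambda>i::nat. if i = 0 then 1 else if i = 1 then z else (0::complex))" for z
  have v: "v z \<in> cspace 2" "v z 0 = 1" "v z 1 = z" for z by (auto simp: v_def cspace_def)
  have mem: "cspan {v z} \<in> proj_space 1" for z
  proof -
    have "v z \<in> cspace (Suc 1) - {0}" using v(1,2)[of z] by (auto simp: numeral_2_eq_2)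
    then show ?thesis by (auto simp: proj_space_def)
  qed
  have \<phi>_v: "\<phi> (cspan {v z}) = F (line z)" for z
    using \<phi>(2)[OF v(1)[of z]] unfolding v(2,3) by (simp cong: if_cong)
  have "F (line z) \<in> \<phi> ` proj_space 1" for z
    unfolding \<phi>_v[symmetric] using mem by (rule imageI)
  from this[of 0] this[of 1] have "{p, q} \<subseteq> \<phi> ` proj_space 1"
    unfolding \<open>F (line 0) = p\<close> \<open>F (line 1) = q\<close> by simp
  then show "\<exists>\<phi>. proj_morphism 1 (proj_space 1) N X \<phi> \<and> {p, q} \<subseteq> \<phi> ` proj_space 1"
    using \<phi>(1) by blast
qed

end
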